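(* Let $G$ be a real Lie group acting continuously on a locally compact second countable metrizable space $X$, and let $E$ be a countable set with a coding map $E\to G$, $e\mapsto g_e$. Suppose a Markov chain on $E$ is irreducible and positive recurrent and let $\pi$ be its stationary distribution. If $\nu$ is a stationary probability measure for the action chain on $E\times X$, then $$\nu=\sum_{e\in E}\pi(\{e\})\,\delta_e\otimes\nu_e,$$ where for each $e\in E$, $\nu_e$ is a $\mu_e$-stationary probability measure on $X$, satisfying $$\pi(\{e\})\nu_e=\sum_{e'\in E}\pi(\{e'\})\,p_{e,e'}\,(g_{e'})_*\nu_{e'}.$$ If $\nu$ is ergodic, then the $\nu_e$ are $\mu_e$-ergodic. Furthermore, if $c\in E^*$ is $(e{\leftarrow}e')$-admissible, we have $(g_c)_*\nu_{e'}\ll\nu_e$, and if moreover $\nu_e$ is $G_e^+$-invariant, then $\nu_e$ and $(g_c)_*\nu_{e'}$ belong to the same measure class.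
   Context: Markov chain notation: $p_{e',e}$ is the probability of going from state $e$ to state $e'$, and $P(e,\cdot)$ is the transition probability distribution from $e$; $\mathbb{P}_e$ is the Markov measure on $E^{\mathbb{N}}$ (indices from $0$) started at $\omega_0=e$, with expectation $\mathbb{E}_e$; $\tau_e(\omega)=\inf\{n\ge1:\omega_n=e\}$. Irreducible: $\mathbb{P}_e[\tau_{e'}<\infty]>0$ for all $e,e'$. Positive recurrent: $\mathbb{E}_e[\tau_e]<\infty$ for all $e$. The action chain is the Markov chain on $E\times X$ with transition kernel $Q((e,x),\cdot)=P(e,\cdot)\otimes\delta_{g_ex}$. A stationary probability measure for it is ergodic if it is extremal among its stationary probability measures. The renewal measure $\mu_e$ is the law on $G$ of $g_{\omega_{\tau_e-1}}\cdots g_{\omega_0}$ under $\mathbb{P}_e$; $G_e^+$ is the closed subsemigroup of $G$ generated by $\operatorname{supp}(\mu_e)$. A probability measure $\eta$ on $X$ is $\mu_e$-stationary if $\int_Gg_*\eta\,d\mu_e(g)=\eta$, and a $\mu_e$-stationary probability measure is $\mu_e$-ergodic if it is extremal among $\mu_e$-stationary probability measures. $E^*$ is the set of finite words over $E$, written right to left: for $w=e_{n-1}\ldots e_0$, $g_w=g_{e_{n-1}}\cdots g_{e_0}$. A non-empty word $w=e_{n-1}\ldots e_0$ is $(e{\leftarrow}e')$-admissible if $e_0=e'$, $p_{e_k,e_{k-1}}>0$ for $1\le k\le n-1$, and $p_{e,e_{n-1}}>0$. *)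

theory Defs
  imports "HOL-Probability.Probability" "HOL-Algebra.Group_Action"
begin

section \<open>Real Lie groups\<close>

text \<open>
  Manifolds are modelled on \<^const>\<open>Euclidean_space\<close> \<open>n\<close> (sequences vanishing from index \<open>n\<close>
  on) rather than on a type of class \<open>euclidean_space\<close>, because the latter has positive dimension
  and would exclude discrete groups.  \<open>C\<^sup>k\<close> is defined by iterated partial derivatives; \<open>U\<close> is
  meant to be open in \<^const>\<open>Euclidean_space\<close> \<open>n\<close>.
\<close>

definition partial_deriv :: "nat \<Rightarrow> ((nat \<Rightarrow> real) \<Rightarrow> real) \<Rightarrow> (nat \<Rightarrow> real) \<Rightarrow> real" where
  "partial_deriv i f x = deriv (\<lambda>t. f (x(i := t))) (x i)"

primrec Ck_on :: "nat \<Rightarrow> nat \<Rightarrow> (nat \<Rightarrow> real) set \<Rightarrow> ((nat \<Rightarrow> real) \<Rightarrow> real) \<Rightarrow> bool" where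
  "Ck_on n 0 U f \<longleftrightarrow> continuous_map (subtopology (Euclidean_space n) U) euclideanreal f"
| "Ck_on n (Suc k) U f \<longleftrightarrow>
     continuous_map (subtopology (Euclidean_space n) U) euclideanreal f \<and>
     (\<forall>i<n. (\<forall>x\<in>U. (\<lambda>t. f (x(i := t))) differentiable (at (x i))) \<and>
            Ck_on n k U (partial_deriv i f))"

definition smooth_on :: "nat \<Rightarrow> nat \<Rightarrow> (nat \<Rightarrow> real) set \<Rightarrow> ((nat \<Rightarrow> real) \<Rightarrow> nat \<Rightarrow> real) \<Rightarrow> bool" where
  "smooth_on n m U F \<longleftrightarrow> (\<forall>j<m. \<forall>k. Ck_on n k U (\<lambda>x. F x j))"

type_synonym 'a chart = "'a set \<times> ('a \<Rightarrow> nat \<Rightarrow> real)"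

definition is_chart :: "'a topology \<Rightarrow> nat \<Rightarrow> 'a chart \<Rightarrow> bool" where
  "is_chart T n c \<longleftrightarrow> (case c of (U, \<phi>) \<Rightarrow>
     openin T U \<and> openin (Euclidean_space n) (\<phi> ` U) \<and>
     homeomorphic_map (subtopology T U) (subtopology (Euclidean_space n) (\<phi> ` U)) \<phi>)"

definition smooth_atlas :: "'a topology \<Rightarrow> nat \<Rightarrow> 'a chart set \<Rightarrow> bool" where
  "smooth_atlas T n A \<longleftrightarrow>
     (\<forall>c\<in>A. is_chart T n c) \<and> (\<Union>(U, \<phi>)\<in>A. U) = topspace T \<and>
     (\<forall>(U, \<phi>)\<in>A. \<forall>(V, \<psi>)\<in>A. smooth_on n n (\<phi> ` (U \<inter> V)) (\<psi> \<circ> inv_into U \<phi>))"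

definition prod_atlas :: "nat \<Rightarrow> 'a chart set \<Rightarrow> 'b chart set \<Rightarrow> ('a \<times> 'b) chart set" where
  "prod_atlas n A B =
     {(U \<times> V, \<lambda>(x, y) i. if i < n then \<phi> x i else \<psi> y (i - n)) | U \<phi> V \<psi>. (U, \<phi>) \<in> A \<and> (V, \<psi>) \<in> B}"

definition smooth_map ::
  "'a topology \<Rightarrow> nat \<Rightarrow> 'a chart set \<Rightarrow> 'b topology \<Rightarrow> nat \<Rightarrow> 'b chart set \<Rightarrow> ('a \<Rightarrow> 'b) \<Rightarrow> bool" where
  "smooth_map S n A T m B f \<longleftrightarrow> continuous_map S T f \<and>
     (\<forall>(U, \<phi>)\<in>A. \<forall>(V, \<psi>)\<in>B. smooth_on n m (\<phi> ` (U \<inter> f -` V)) (\<psi> \<circ> f \<circ> inv_into U \<phi>))"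

text \<open>
  \<open>T\<close> is the topology of the Lie group; its smooth structure is unique, hence existentially
  quantified.  Second countability is not required, so that groups with uncountably many
  components are included.
\<close>

definition lie_group :: "('g, 'm) monoid_scheme \<Rightarrow> 'g topology \<Rightarrow> bool" where
  "lie_group G T \<longleftrightarrow> group G \<and> topspace T = carrier G \<and> Hausdorff_space T \<and>
     (\<exists>n A. smooth_atlas T n A \<and>
        smooth_map (prod_topology T T) (n + n) (prod_atlas n A A) T n A (\<lambda>(a, b). a \<otimes>\<^bsub>G\<^esub> b) \<and>
        smooth_map T n A T n A (\<lambda>a. inv\<^bsub>G\<^esub> a))"

definition continuous_action ::
  "('g, 'm) monoid_scheme \<Rightarrow> 'g topology \<Rightarrow> 'x topology \<Rightarrow> ('g \<Rightarrow> 'x \<Rightarrow> 'x) \<Rightarrow> bool" where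
  "continuous_action G T X act \<longleftrightarrow> group_action G (topspace X) act \<and>
     continuous_map (prod_topology T X) X (\<lambda>(h, x). act h x)"


section \<open>Measures on topological spaces\<close>

definition borel_of :: "'a topology \<Rightarrow> 'a measure" where
  "borel_of T = sigma (topspace T) {U. openin T U}"

definition measure_support :: "'a topology \<Rightarrow> 'a measure \<Rightarrow> 'a set" where
  "measure_support T \<mu> = {x \<in> topspace T. \<forall>U. openin T U \<and> x \<in> U \<longrightarrow> 0 < emeasure \<mu> U}"

definition closed_subsemigroup :: "('g, 'm) monoid_scheme \<Rightarrow> 'g topology \<Rightarrow> 'g set \<Rightarrow> bool" where
  "closed_subsemigroup G T H \<longleftrightarrow> closedin T H \<and> (\<forall>a\<in>H. \<forall>b\<in>H. a \<otimes>\<^bsub>G\<^esub> b \<in> H)"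

text \<open>\<open>pushforward X f \<eta>\<close> is the measure \<open>f\<^sub>*\<eta>\<close> on \<open>X\<close>.\<close>

abbreviation pushforward :: "'x topology \<Rightarrow> ('x \<Rightarrow> 'x) \<Rightarrow> 'x measure \<Rightarrow> 'x measure" where
  "pushforward X f \<eta> \<equiv> distr \<eta> (borel_of X) f"

definition extremal_in :: "'a measure set \<Rightarrow> 'a measure \<Rightarrow> bool" where
  "extremal_in S \<nu> \<longleftrightarrow> \<nu> \<in> S \<and>
     (\<forall>\<nu>1\<in>S. \<forall>\<nu>2\<in>S. \<forall>t::real. 0 < t \<and> t < 1 \<and>
        (\<forall>A\<in>sets \<nu>. emeasure \<nu> A = ennreal t * emeasure \<nu>1 A + ennreal (1 - t) * emeasure \<nu>2 A)
        \<longrightarrow> \<nu>1 = \<nu> \<and> \<nu>2 = \<nu>)"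

definition stationary_probs :: "'a measure \<Rightarrow> ('a \<Rightarrow> 'a measure) \<Rightarrow> 'a measure set" where
  "stationary_probs M Q = {\<nu>. prob_space \<nu> \<and> sets \<nu> = sets M \<and>
     (\<forall>A\<in>sets M. emeasure \<nu> A = (\<integral>\<^sup>+z. emeasure (Q z) A \<partial>\<nu>))}"

definition convolution_stationary_probs ::
  "'x topology \<Rightarrow> ('g \<Rightarrow> 'x \<Rightarrow> 'x) \<Rightarrow> 'g measure \<Rightarrow> 'x measure set" where
  "convolution_stationary_probs X act \<mu> = {\<eta>. prob_space \<eta> \<and> sets \<eta> = sets (borel_of X) \<and>
     (\<forall>A\<in>sets (borel_of X). emeasure \<eta> A = (\<integral>\<^sup>+h. emeasure (pushforward X (act h) \<eta>) A \<partial>\<mu>))}"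


section \<open>Markov chains on a countable set\<close>

text \<open>
  A Markov chain is given by \<open>K :: 'e \<Rightarrow> 'e pmf\<close>, where \<open>K e\<close> is the distribution \<open>P(e, \<cdot>)\<close>; thus
  \<open>p\<^bsub>e',e\<^esub>\<close>, the probability of going from \<open>e\<close> to \<open>e'\<close>, is \<open>pmf (K e) e'\<close>.  The path measure is
  the Ionescu-Tulcea limit of the one-step kernels.
\<close>

definition path_step :: "('e \<Rightarrow> 'e pmf) \<Rightarrow> 'e \<Rightarrow> nat \<Rightarrow> (nat \<Rightarrow> 'e) \<Rightarrow> 'e measure" where
  "path_step K e n \<omega> =
     (case n of 0 \<Rightarrow> return (count_space UNIV) e | Suc m \<Rightarrow> measure_pmf (K (\<omega> m)))"

definition markov_measure :: "('e \<Rightarrow> 'e pmf) \<Rightarrow> 'e \<Rightarrow> (nat \<Rightarrow> 'e) measure" where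
  "markov_measure K e =
     projective_family.lim UNIV (Ionescu_Tulcea.CI (path_step K e) (\<lambda>_. count_space UNIV))
       (\<lambda>_. count_space UNIV)"

lemma Ionescu_Tulcea_path_step: "Ionescu_Tulcea (path_step K e) (\<lambda>_. count_space UNIV)"
proof (rule Ionescu_Tulcea.intro)
  show "path_step K e i \<in> measurable (PiM {0..<i} (\<lambda>_. count_space UNIV))
          (subprob_algebra (count_space UNIV))" for i
  proof (cases i)
    case 0
    have "return (count_space UNIV) e \<in> space (subprob_algebra (count_space UNIV))"
      by (auto simp: space_subprob_algebra intro!: prob_space_imp_subprob_space prob_space_return)
    then show ?thesis
      unfolding 0 path_step_def by simp
  next
    case (Suc m)
    have K: "(\<lambda>e'. measure_pmf (K e')) \<in> measurable (count_space UNIV) (subprob_algebra (count_space UNIV))"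
      by (auto simp: space_subprob_algebra intro!: prob_space_imp_subprob_space measure_pmf.prob_space_axioms)
    have "(\<lambda>\<omega>. \<omega> m) \<in> measurable (PiM {0..<Suc m} (\<lambda>_. count_space UNIV)) (count_space (UNIV::'a set))"
      by (rule measurable_component_singleton) simp
    from measurable_compose[OF this K] show ?thesis
      by (simp add: Suc path_step_def[abs_def])
  qed
  show "prob_space (path_step K e i x)" for i x
    by (cases i) (auto simp: path_step_def intro!: prob_space_return measure_pmf.prob_space_axioms)
qed

definition return_time :: "'e \<Rightarrow> (nat \<Rightarrow> 'e) \<Rightarrow> enat" where
  "return_time e \<omega> = Inf (enat ` {n. 1 \<le> n \<and> \<omega> n = e})"

definition irreducible_chain :: "('e \<Rightarrow> 'e pmf) \<Rightarrow> bool" where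
  "irreducible_chain K \<longleftrightarrow> (\<forall>e e'. 0 < emeasure (markov_measure K e)
     {\<omega> \<in> space (markov_measure K e). return_time e' \<omega> < \<infinity>})"

definition positive_recurrent :: "('e \<Rightarrow> 'e pmf) \<Rightarrow> bool" where
  "positive_recurrent K \<longleftrightarrow>
     (\<forall>e. (\<integral>\<^sup>+\<omega>. ennreal_of_enat (return_time e \<omega>) \<partial>markov_measure K e) < \<infinity>)"

text \<open>
  The word \<open>e\<^sub>n\<^sub>-\<^sub>1 \<dots> e\<^sub>0\<close> is the list \<open>[e\<^sub>n\<^sub>-\<^sub>1, \<dots>, e\<^sub>0]\<close>, so its letter \<open>e\<^sub>k\<close> is \<open>rev w ! k\<close>.
\<close>

definition word_prod :: "('g, 'm) monoid_scheme \<Rightarrow> ('e \<Rightarrow> 'g) \<Rightarrow> 'e list \<Rightarrow> 'g" where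
  "word_prod G g w = foldr (\<lambda>e h. g e \<otimes>\<^bsub>G\<^esub> h) w \<one>\<^bsub>G\<^esub>"

text \<open>\<open>admissible K e e' w\<close>: the word \<open>w\<close> is \<open>(e \<leftarrow> e')\<close>-admissible.\<close>

definition admissible :: "('e \<Rightarrow> 'e pmf) \<Rightarrow> 'e \<Rightarrow> 'e \<Rightarrow> 'e list \<Rightarrow> bool" where
  "admissible K e e' w \<longleftrightarrow> w \<noteq> [] \<and> rev w ! 0 = e' \<and>
     (\<forall>k. 1 \<le> k \<and> k \<le> length w - 1 \<longrightarrow> 0 < pmf (K (rev w ! (k - 1))) (rev w ! k)) \<and>
     0 < pmf (K (rev w ! (length w - 1))) e"


section \<open>The action chain and renewal measures\<close>

definition action_kernel ::
  "'x topology \<Rightarrow> ('g \<Rightarrow> 'x \<Rightarrow> 'x) \<Rightarrow> ('e \<Rightarrow> 'g) \<Rightarrow> ('e \<Rightarrow> 'e pmf) \<Rightarrow> 'e \<times> 'x \<Rightarrow> ('e \<times> 'x) measure" where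
  "action_kernel X act g K =
     (\<lambda>(e, x). measure_pmf (K e) \<Otimes>\<^sub>M return (borel_of X) (act (g e) x))"

definition action_stationary_probs ::
  "'x topology \<Rightarrow> ('g \<Rightarrow> 'x \<Rightarrow> 'x) \<Rightarrow> ('e \<Rightarrow> 'g) \<Rightarrow> ('e \<Rightarrow> 'e pmf) \<Rightarrow> ('e \<times> 'x) measure set" where
  "action_stationary_probs X act g K =
     stationary_probs (count_space UNIV \<Otimes>\<^sub>M borel_of X) (action_kernel X act g K)"

text \<open>
  For recurrent chains the return time is almost surely finite, so the value of \<^const>\<open>the_enat\<close>
  at \<open>\<infinity>\<close> is irrelevant.
\<close>

definition renewal_measure ::
  "('g, 'm) monoid_scheme \<Rightarrow> 'g topology \<Rightarrow> ('e \<Rightarrow> 'g) \<Rightarrow> ('e \<Rightarrow> 'e pmf) \<Rightarrow> 'e \<Rightarrow> 'g measure" where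
  "renewal_measure G T g K e = distr (markov_measure K e) (borel_of T)
     (\<lambda>\<omega>. word_prod G g (rev (map \<omega> [0..<the_enat (return_time e \<omega>)])))"

definition renewal_semigroup ::
  "('g, 'm) monoid_scheme \<Rightarrow> 'g topology \<Rightarrow> ('e \<Rightarrow> 'g) \<Rightarrow> ('e \<Rightarrow> 'e pmf) \<Rightarrow> 'e \<Rightarrow> 'g set" where
  "renewal_semigroup G T g K e =
     closed_subsemigroup G T hull measure_support T (renewal_measure G T g K e)"

end

theory Submission
  imports Defs
begin

text \<open>
  Write \<open>m f = \<pi>({f}) \<nu>\<^sub>f\<close> for the restriction of \<open>\<nu>\<close> to \<open>{f} \<times> X\<close>.  Unfolding the stationarity
  equation of \<open>m\<close> along excursions from a state \<open>e\<close> shows that \<open>m\<close> dominates the suspension of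
  \<open>m e\<close>, the sum over all excursions of the transported measure \<open>m e\<close>.  By irreducibility and
  recurrence both have the same mass on every fiber, so they agree.  Closing the excursions up at
  \<open>e\<close> turns this into \<open>\<mu>\<^sub>e\<close>-stationarity of \<open>m e\<close>; conversely, suspending a \<open>\<mu>\<^sub>e\<close>-stationary measure
  gives a stationary measure of the action chain.  Suspension is linear, so it carries a convex
  decomposition of \<open>\<nu>\<^sub>e\<close> to one of \<open>\<nu>\<close>, whence extremality.  Finally, stationarity bounds \<open>m e\<close>
  below by a positive multiple of \<open>(g\<^sub>c)\<^sub>*(m e')\<close>, and every admissible loop at \<open>e\<close> is a product of
  first-return loops, which are atoms of \<open>\<mu>\<^sub>e\<close>.
\<close>


section \<open>Path words and admissible words\<close>

text \<open>Words list the newest letter first, as in \<^const>\<open>word_prod\<close> and \<^const>\<open>admissible\<close>.\<close>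

primrec path_pmf :: "('e \<Rightarrow> 'e pmf) \<Rightarrow> 'e \<Rightarrow> nat \<Rightarrow> 'e list pmf" where
  "path_pmf K e 0 = return_pmf [e]"
| "path_pmf K e (Suc n) = bind_pmf (path_pmf K e n) (\<lambda>w. map_pmf (\<lambda>x. x # w) (K (hd w)))"

lemma measurable_path_word:
  fixes n :: nat
  assumes "{..<n} \<subseteq> J"
  shows "(\<lambda>\<omega>. rev (map \<omega> [0..<n])) \<in>
    measurable (PiM J (\<lambda>_. count_space UNIV)) (count_space (UNIV :: 'e::countable list set))"
  using assms
proof (induction n)
  case (Suc n)
  have "(\<lambda>\<omega>. \<omega> n) \<in> measurable (PiM J (\<lambda>_. count_space UNIV)) (count_space (UNIV :: 'e set))"
    using Suc.prems by (intro measurable_component_singleton) auto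
  moreover have "(\<lambda>\<omega>. rev (map \<omega> [0..<n])) \<in>
      measurable (PiM J (\<lambda>_. count_space UNIV)) (count_space (UNIV :: 'e list set))"
    using Suc by (auto simp: lessThan_Suc)
  ultimately show ?case
    by (simp add: measurable_compose_countable[where f = "\<lambda>x \<omega>. x # rev (map \<omega> [0..<n])"]
        measurable_compose_countable[where g = "\<lambda>\<omega>. rev (map \<omega> [0..<n])"] )
qed simp

lemma sets_markov_measure:
  "sets (markov_measure K e) = sets (PiM UNIV (\<lambda>_. count_space UNIV))"
proof -
  interpret IT: Ionescu_Tulcea "path_step K e" "\<lambda>_. count_space UNIV"
    by (rule Ionescu_Tulcea_path_step)
  show ?thesis
    unfolding markov_measure_def by (rule IT.PF.sets_lim)
qed

lemma space_markov_measure [simp]: "space (markov_measure K e) = UNIV"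
  using sets_eq_imp_space_eq[OF sets_markov_measure, of K e] by (simp add: space_PiM)

lemma distr_markov_measure_path:
  fixes K :: "'e::countable \<Rightarrow> 'e pmf"
  shows "distr (markov_measure K e) (count_space UNIV) (\<lambda>\<omega>. rev (map \<omega> [0..<Suc n])) = path_pmf K e n"
proof -
  let ?M = "\<lambda>J :: nat set. PiM J (\<lambda>_. count_space (UNIV :: 'e set))"
  let ?L = "\<lambda>n \<omega>. rev (map \<omega> [0..<n]) :: 'e list"
  interpret IT: Ionescu_Tulcea "path_step K e" "\<lambda>_. count_space UNIV"
    by (rule Ionescu_Tulcea_path_step)
  have L: "?L n \<in> measurable (?M {0..<n}) (count_space UNIV)" for n
    by (rule measurable_path_word) auto
  have *: "(\<lambda>_. undefined) \<in> space (?M {0..<0})"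
    by (simp add: space_PiM)
  have ne: "space (IT.C 0 n (\<lambda>_. undefined)) \<noteq> {}" for n
    using IT.prob_space_C[OF *, of n] by (rule prob_space.not_empty)
  have sC: "sets (IT.C 0 n (\<lambda>_. undefined)) = sets (?M {0..<n})" for n
    using IT.sets_C[OF *, of n] by simp
  have distr_eP: "distr (IT.eP n \<omega>) (count_space UNIV) (?L (Suc n)) =
      distr (path_step K e n \<omega>) (count_space UNIV) (\<lambda>x. x # ?L n \<omega>)" if "\<omega> \<in> space (?M {0..<n})" for n \<omega>
  proof -
    have "fun_upd \<omega> n \<in> measurable (path_step K e n \<omega>) (?M {0..<Suc n})"
      using that by (intro measurable_fun_upd[where J = "{0..<n}"]) (auto simp: measurable_cong_sets[OF IT.sets_P[OF that] refl])
    from distr_distr[OF L[of "Suc n"] this]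
    have "distr (IT.eP n \<omega>) (count_space UNIV) (?L (Suc n)) =
        distr (path_step K e n \<omega>) (count_space UNIV) (?L (Suc n) \<circ> fun_upd \<omega> n)"
      unfolding IT.eP_def .
    also have "?L (Suc n) \<circ> fun_upd \<omega> n = (\<lambda>x. x # ?L n \<omega>)"
      by (auto simp: fun_eq_iff)
    finally show ?thesis .
  qed
  have C: "distr (IT.C 0 (Suc n) (\<lambda>_. undefined)) (count_space UNIV) (?L (Suc n)) = path_pmf K e n" for n
  proof (induction n)
    case 0
    have "IT.C 0 (Suc 0) (\<lambda>_. undefined) = IT.eP 0 (\<lambda>_. undefined)"
      using bind_return[OF IT.measurable_eP *] by simp
    moreover have "path_step K e 0 (\<lambda>_. undefined) = return (count_space UNIV) e"
      by (simp add: path_step_def)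
    ultimately show ?case
      using distr_eP[OF *] by (simp add: distr_return return_pmf.rep_eq del: upt_Suc IT.C.simps)
  next
    case (Suc n)
    have K: "(\<lambda>w. measure_pmf (map_pmf (\<lambda>x. x # w) (K (hd w)))) \<in>
        measurable (count_space UNIV) (subprob_algebra (count_space UNIV))"
      by (auto simp: space_subprob_algebra intro!: prob_space_imp_subprob_space measure_pmf.prob_space_axioms)
    have "distr (IT.C 0 (Suc (Suc n)) (\<lambda>_. undefined)) (count_space UNIV) (?L (Suc (Suc n))) =
        IT.C 0 (Suc n) (\<lambda>_. undefined) \<bind>
          (\<lambda>\<omega>. distr (IT.eP (Suc n) \<omega>) (count_space UNIV) (?L (Suc (Suc n))))"
      using IT.measurable_eP[of "Suc n"] L[of "Suc (Suc n)"] ne[of "Suc n"]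
      unfolding IT.C.simps(2)[of 0 "Suc n"] add_0
      by (intro distr_bind[where K = "?M {0..<Suc (Suc n)}"])
         (simp_all add: measurable_cong_sets[OF sC refl] del: upt_Suc IT.C.simps)
    also have "\<dots> = IT.C 0 (Suc n) (\<lambda>_. undefined) \<bind>
          (\<lambda>\<omega>. measure_pmf (map_pmf (\<lambda>x. x # ?L (Suc n) \<omega>) (K (hd (?L (Suc n) \<omega>)))))"
    proof (rule bind_cong[OF refl])
      fix \<omega> assume "\<omega> \<in> space (IT.C 0 (Suc n) (\<lambda>_. undefined))"
      then have "\<omega> \<in> space (?M {0..<Suc n})"
        using sets_eq_imp_space_eq[OF sC[of "Suc n"]] by simp
      from distr_eP[OF this]
      show "distr (IT.eP (Suc n) \<omega>) (count_space UNIV) (?L (Suc (Suc n))) =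
          measure_pmf (map_pmf (\<lambda>x. x # ?L (Suc n) \<omega>) (K (hd (?L (Suc n) \<omega>))))"
        unfolding map_pmf_rep_eq path_step_def by simp
    qed
    also have "\<dots> = distr (IT.C 0 (Suc n) (\<lambda>_. undefined)) (count_space UNIV) (?L (Suc n)) \<bind>
        (\<lambda>w. measure_pmf (map_pmf (\<lambda>x. x # w) (K (hd w))))"
      using L[of "Suc n"] ne[of "Suc n"] K
      by (subst bind_distr) (simp_all add: measurable_cong_sets[OF sC refl] del: upt_Suc IT.C.simps)
    finally show ?case
      unfolding Suc.IH by (simp add: measure_pmf_bind)
  qed
  have CI: "IT.CI {0..<Suc n} = IT.C 0 (Suc n) (\<lambda>_. undefined)"
  proof -
    have *: "IT.up_to {0..<Suc n} \<le> Suc n"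
      by (subst IT.up_to_iff_Ico) auto
    have "Suc n \<le> IT.up_to {0..<Suc n}"
      using IT.up_to_less[of "{0..<Suc n}" n] by auto
    with * have u: "IT.up_to {0..<Suc n} = Suc n" by simp
    show ?thesis
      unfolding IT.CI_def u
      by (subst distr_cong[OF refl _, where g = "\<lambda>x. x"])
         (auto simp: distr_id2 sC space_PiM sets_eq_imp_space_eq[OF sC] restrict_def PiE_def extensional_def fun_eq_iff simp del: IT.C.simps)
  qed
  have r: "(\<lambda>\<omega>. restrict \<omega> {0..<Suc n}) \<in> measurable (markov_measure K e) (?M {0..<Suc n})"
    unfolding measurable_cong_sets[OF sets_markov_measure refl] by (rule measurable_restrict_subset) auto
  have "measure_pmf (path_pmf K e n) = distr (distr (markov_measure K e) (?M {0..<Suc n}) (\<lambda>\<omega>. restrict \<omega> {0..<Suc n}))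
      (count_space UNIV) (?L (Suc n))"
    using IT.distr_lim[of "{0..<Suc n}"] C[of n] unfolding markov_measure_def CI by simp
  also have "\<dots> = distr (markov_measure K e) (count_space UNIV) (?L (Suc n))"
    using L[of "Suc n"] r by (subst distr_distr) (auto simp: comp_def restrict_def intro!: distr_cong)
  finally show ?thesis ..
qed

lemma nn_integral_count_space_delta:
  "(\<integral>\<^sup>+x. (if x = a then f x else 0) \<partial>count_space UNIV) = (f a :: ennreal)"
proof -
  have "(\<integral>\<^sup>+x. (if x = a then f x else 0) \<partial>count_space UNIV) =
      (\<integral>\<^sup>+x. f x * indicator {a} x \<partial>count_space UNIV)"
    by (intro nn_integral_cong) auto
  then show ?thesis
    by (simp add: one_ennreal_def[symmetric])
qed

lemma nn_integral_pmf_delta: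
  "(\<integral>\<^sup>+x. (if x = a then c else 0) \<partial>measure_pmf p) = ennreal (pmf p a) * c"
proof -
  have "(\<integral>\<^sup>+x. (if x = a then c else 0) \<partial>measure_pmf p) =
      (\<integral>\<^sup>+x. (if x = a then ennreal (pmf p x) * c else 0) \<partial>count_space UNIV)"
    unfolding nn_integral_measure_pmf by (intro nn_integral_cong) auto
  then show ?thesis
    by (simp add: nn_integral_count_space_delta)
qed

lemma path_pmf_nonempty: "w \<in> set_pmf (path_pmf K e n) \<Longrightarrow> w \<noteq> []"
  by (cases n) auto

lemma return_time_eq_enat_iff:
  "return_time e \<omega> = enat n \<longleftrightarrow> 1 \<le> n \<and> \<omega> n = e \<and> (\<forall>k. 1 \<le> k \<and> k < n \<longrightarrow> \<omega> k \<noteq> e)"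
proof
  assume *: "return_time e \<omega> = enat n"
  then have ne: "{n. 1 \<le> n \<and> \<omega> n = e} \<noteq> {}"
    unfolding return_time_def by (auto simp: Inf_enat_def split: if_splits)
  then have "Inf (enat ` {n. 1 \<le> n \<and> \<omega> n = e}) \<in> enat ` {n. 1 \<le> n \<and> \<omega> n = e}"
    unfolding Inf_enat_def by (auto intro: LeastI)
  moreover have "enat n \<le> enat k" if "1 \<le> k" "\<omega> k = e" for k
    unfolding *[symmetric] return_time_def using that by (intro Inf_lower) auto
  ultimately show "1 \<le> n \<and> \<omega> n = e \<and> (\<forall>k. 1 \<le> k \<and> k < n \<longrightarrow> \<omega> k \<noteq> e)"
    using * unfolding return_time_def by fastforce
next
  assume *: "1 \<le> n \<and> \<omega> n = e \<and> (\<forall>k. 1 \<le> k \<and> k < n \<longrightarrow> \<omega> k \<noteq> e)"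
  show "return_time e \<omega> = enat n"
    unfolding return_time_def
  proof (rule antisym)
    show "Inf (enat ` {n. 1 \<le> n \<and> \<omega> n = e}) \<le> enat n"
      using * by (intro Inf_lower) auto
    show "enat n \<le> Inf (enat ` {n. 1 \<le> n \<and> \<omega> n = e})"
      using * by (intro Inf_greatest) (force simp: not_less[symmetric])
  qed
qed

lemma return_time_less_top_iff: "return_time e \<omega> < \<infinity> \<longleftrightarrow> (\<exists>n\<ge>1. \<omega> n = e)"
proof
  assume "return_time e \<omega> < \<infinity>"
  then obtain n where "return_time e \<omega> = enat n" by auto
  then show "\<exists>n\<ge>1. \<omega> n = e" unfolding return_time_eq_enat_iff by blast
next
  assume "\<exists>n\<ge>1. \<omega> n = e"
  then obtain n where "1 \<le> n" "\<omega> n = e" by blast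
  then have "return_time e \<omega> \<le> enat n"
    unfolding return_time_def by (intro Inf_lower) auto
  then show "return_time e \<omega> < \<infinity>"
    using enat_ord_code(4) le_less_trans by blast
qed

lemma measurable_component_markov [measurable]:
  fixes K :: "'e \<Rightarrow> 'e pmf"
  shows "(\<lambda>\<omega>. \<omega> n) \<in> measurable (markov_measure K e) (count_space (UNIV :: 'e set))"
  unfolding measurable_cong_sets[OF sets_markov_measure refl] by (rule measurable_component_singleton) simp

lemma measurable_word_markov:
  fixes K :: "'e::countable \<Rightarrow> 'e pmf"
  shows "(\<lambda>\<omega>. rev (map \<omega> [0..<n])) \<in> measurable (markov_measure K e) (count_space UNIV)"
  unfolding measurable_cong_sets[OF sets_markov_measure refl] by (rule measurable_path_word) simp

lemma nn_integral_path_pmf: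
  fixes K :: "'e::countable \<Rightarrow> 'e pmf"
  shows "(\<integral>\<^sup>+w. f w \<partial>path_pmf K e n) = (\<integral>\<^sup>+\<omega>. f (rev (map \<omega> [0..<Suc n])) \<partial>markov_measure K e)"
  unfolding distr_markov_measure_path[symmetric]
  by (rule nn_integral_distr[OF measurable_word_markov]) simp

lemma prob_space_markov_measure:
  fixes K :: "'e::countable \<Rightarrow> 'e pmf"
  shows "prob_space (markov_measure K e)"
proof
  have "emeasure (markov_measure K e) (space (markov_measure K e)) =
      (\<integral>\<^sup>+\<omega>. (\<lambda>_. 1) (rev (map \<omega> [0..<Suc 0])) \<partial>markov_measure K e)"
    by simp
  also have "\<dots> = (\<integral>\<^sup>+w. 1 \<partial>path_pmf K e 0)"
    by (rule nn_integral_path_pmf[symmetric])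
  finally show "emeasure (markov_measure K e) (space (markov_measure K e)) = 1"
    by simp
qed

lemma positive_recurrent_AE_return:
  fixes K :: "'e::countable \<Rightarrow> 'e pmf"
  assumes "positive_recurrent K"
  shows "AE \<omega> in markov_measure K e. return_time e \<omega> < \<infinity>"
proof -
  let ?N = "{\<omega>. \<forall>n. 1 \<le> n \<longrightarrow> \<omega> n \<noteq> e}"
  have [measurable]: "Measurable.pred (markov_measure K e) (\<lambda>\<omega>. \<forall>n. 1 \<le> n \<longrightarrow> \<omega> n \<noteq> e)"
    by measurable
  then have N: "?N \<in> sets (markov_measure K e)"
    unfolding pred_def by simp
  have "\<infinity> * emeasure (markov_measure K e) ?N = (\<integral>\<^sup>+\<omega>. \<infinity> * indicator ?N \<omega> \<partial>markov_measure K e)"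
    using N by (simp add: nn_integral_cmult_indicator)
  also have "\<dots> \<le> (\<integral>\<^sup>+\<omega>. ennreal_of_enat (return_time e \<omega>) \<partial>markov_measure K e)"
  proof (rule nn_integral_mono)
    fix \<omega>
    have "return_time e \<omega> = \<infinity>" if "\<omega> \<in> ?N"
      using that return_time_less_top_iff[of e \<omega>] by auto
    then show "\<infinity> * indicator ?N \<omega> \<le> ennreal_of_enat (return_time e \<omega>)"
      by (auto split: split_indicator)
  qed
  also have "\<dots> < \<infinity>"
    using assms unfolding positive_recurrent_def by blast
  finally have "emeasure (markov_measure K e) ?N = 0"
    by (auto simp: ennreal_mult_eq_top_iff less_top[symmetric] top_unique)
  then show ?thesis
    using N by (intro AE_I[of _ _ ?N] subsetI) (simp_all only: mem_Collect_eq return_time_less_top_iff, blast)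
qed

lemma admissible_Cons:
  "admissible K f e (x # w) \<longleftrightarrow> 0 < pmf (K x) f \<and> (if w = [] then x = e else admissible K x e w)"
proof (cases "w = []")
  case False
  then have [simp]: "rev w \<noteq> []" by simp
  have "(\<forall>k. 1 \<le> k \<and> k \<le> length w \<longrightarrow> 0 < pmf (K ((rev w @ [x]) ! (k - 1))) ((rev w @ [x]) ! k)) \<longleftrightarrow>
      (\<forall>k. 1 \<le> k \<and> k \<le> length w - 1 \<longrightarrow> 0 < pmf (K (rev w ! (k - 1))) (rev w ! k)) \<and>
      0 < pmf (K (rev w ! (length w - 1))) x" (is "?A \<longleftrightarrow> ?B")
  proof
    assume A: ?A
    have "0 < pmf (K (rev w ! (k - 1))) (rev w ! k)" if "1 \<le> k" "k \<le> length w - 1" for k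
    proof -
      have "k - 1 < length w" "k < length w" using that by auto
      then show ?thesis
        using A[rule_format, of k] that by (simp add: nth_append)
    qed
    moreover have "0 < pmf (K (rev w ! (length w - 1))) x"
      using A[rule_format, of "length w"] False by (auto simp: nth_append Suc_le_eq)
    ultimately show ?B by blast
  next
    assume B: ?B
    show ?A
    proof (intro allI impI)
      fix k assume k: "1 \<le> k \<and> k \<le> length w"
      show "0 < pmf (K ((rev w @ [x]) ! (k - 1))) ((rev w @ [x]) ! k)"
        using B k by (cases "k = length w") (auto simp: nth_append)
    qed
  qed
  then show ?thesis
    using False unfolding admissible_def by (auto simp: nth_append)
qed (auto simp: admissible_def)

lemma not_admissible_Nil [simp]: "\<not> admissible K f e []"
  by (simp add: admissible_def)

lemma admissible_last: "admissible K f e w \<Longrightarrow> last w = e"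
  by (induction w arbitrary: f) (auto simp: admissible_Cons split: if_splits)

lemma admissible_append:
  "v \<noteq> [] \<Longrightarrow> w \<noteq> [] \<Longrightarrow>
    admissible K f e (v @ w) \<longleftrightarrow> admissible K f (last v) v \<and> admissible K (last v) e w"
proof (induction v arbitrary: f)
  case (Cons x v)
  then show ?case
    by (cases "v = []") (auto simp: admissible_Cons)
qed simp

lemma admissible_of_path:
  "w \<in> set_pmf (path_pmf K e (Suc n)) \<Longrightarrow> admissible K (hd w) e (tl w)"
proof (induction n arbitrary: w)
  case 0
  then show ?case
    by (auto simp: admissible_Cons pmf_positive_iff)
next
  case (Suc n)
  from Suc.prems obtain v x where v: "v \<in> set_pmf (path_pmf K e (Suc n))" "x \<in> set_pmf (K (hd v))" "w = x # v"
    unfolding path_pmf.simps(2)[of K e "Suc n"] set_bind_pmf set_map_pmf by blast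
  from v(1) obtain y u where u: "v = y # u" "u \<noteq> []"
    by (auto dest: path_pmf_nonempty)
  then show ?case
    using v Suc.IH[OF v(1)] by (auto simp: admissible_Cons pmf_positive_iff)
qed

lemma path_of_admissible:
  "admissible K f e w \<Longrightarrow> f # w \<in> set_pmf (path_pmf K e (length w))"
proof (induction w arbitrary: f)
  case (Cons x w)
  show ?case
  proof (cases "w = []")
    case False
    with Cons have "x # w \<in> set_pmf (path_pmf K e (length w))" "0 < pmf (K x) f"
      by (auto simp: admissible_Cons)
    then show ?thesis
      by (auto simp: pmf_positive_iff intro!: bexI[of _ "x # w"])
  qed (use Cons.prems in \<open>auto simp: admissible_Cons pmf_positive_iff\<close>)
qed simp

lemma irreducible_chain_admissible:
  fixes K :: "'e::countable \<Rightarrow> 'e pmf"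
  assumes "irreducible_chain K"
  obtains w where "admissible K f e w"
proof -
  let ?A = "\<lambda>n. {\<omega>. \<omega> (Suc n) = f}"
  have A: "?A n \<in> sets (markov_measure K e)" for n
  proof -
    have "Measurable.pred (markov_measure K e) (\<lambda>\<omega>. \<omega> (Suc n) = f)"
      by measurable
    then show ?thesis unfolding pred_def by simp
  qed
  have "{\<omega> \<in> space (markov_measure K e). return_time f \<omega> < \<infinity>} = (\<Union>n. ?A n)"
  proof (rule Set.set_eqI)
    fix \<omega> :: "nat \<Rightarrow> 'e"
    have "(\<exists>n\<ge>1. \<omega> n = f) \<longleftrightarrow> (\<exists>n. \<omega> (Suc n) = f)"
      by (metis One_nat_def Suc_le_D le_add1 plus_1_eq_Suc)
    then show "\<omega> \<in> {\<omega> \<in> space (markov_measure K e). return_time f \<omega> < \<infinity>} \<longleftrightarrow> \<omega> \<in> (\<Union>n. ?A n)"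
      unfolding mem_Collect_eq return_time_less_top_iff by simp
  qed
  then have "0 < emeasure (markov_measure K e) (\<Union>n. ?A n)"
    using assms[unfolded irreducible_chain_def, rule_format, of e f] by (simp only:)
  moreover have "emeasure (markov_measure K e) (\<Union>n. ?A n) = 0"
    if "\<And>n. emeasure (markov_measure K e) (?A n) = 0"
    using A that by (intro emeasure_UN_eq_0) auto
  ultimately obtain n where n: "emeasure (markov_measure K e) (?A n) \<noteq> 0"
    by (metis less_irrefl)
  have "emeasure (markov_measure K e) (?A n) = (\<integral>\<^sup>+\<omega>. indicator {w. hd w = f} (rev (map \<omega> [0..<Suc (Suc n)])) \<partial>markov_measure K e)"
    unfolding nn_integral_indicator[OF A, symmetric] by (intro nn_integral_cong) (auto split: split_indicator)
  also have "\<dots> = emeasure (path_pmf K e (Suc n)) {w. hd w = f}"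
    by (subst nn_integral_path_pmf[symmetric], rule nn_integral_indicator) simp
  finally have "set_pmf (path_pmf K e (Suc n)) \<inter> {w. hd w = f} \<noteq> {}"
    using n measure_pmf_zero_iff[of "path_pmf K e (Suc n)" "{w. hd w = f}"]
    by (auto simp: measure_pmf.emeasure_eq_measure)
  then show thesis
    using admissible_of_path that by fastforce
qed


section \<open>Excursions of a chain acting by pull-back\<close>

text \<open>
  Measures enter as set functions: a family \<open>m\<close> assigns a value to each state and each element of
  an abstract type \<open>'b\<close> (later, Borel sets), and the letter \<open>x\<close> pushes forward by evaluating at
  \<open>s x b\<close> (later, \<open>g\<^sub>x\<^sup>-\<^sup>1 b\<close>).
\<close>

locale pullback_chain =
  fixes K :: "'e::countable \<Rightarrow> 'e pmf" and s :: "'e \<Rightarrow> 'b \<Rightarrow> 'b"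
begin

definition step :: "('e \<Rightarrow> 'b \<Rightarrow> ennreal) \<Rightarrow> 'e \<Rightarrow> 'b \<Rightarrow> ennreal" where
  "step m f b = (\<integral>\<^sup>+f'. ennreal (pmf (K f') f) * m f' (s f' b) \<partial>count_space UNIV)"

primrec excursion :: "'e \<Rightarrow> ('b \<Rightarrow> ennreal) \<Rightarrow> nat \<Rightarrow> 'e \<Rightarrow> 'b \<Rightarrow> ennreal" where
  "excursion e h 0 f b = (if f = e then h b else 0)"
| "excursion e h (Suc n) f b = (if f = e then 0 else step (excursion e h n) f b)"

definition suspension :: "'e \<Rightarrow> ('b \<Rightarrow> ennreal) \<Rightarrow> 'e \<Rightarrow> 'b \<Rightarrow> ennreal" where
  "suspension e h f b = (\<Sum>n. excursion e h n f b)"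

definition first_return :: "'e \<Rightarrow> ('b \<Rightarrow> ennreal) \<Rightarrow> 'b \<Rightarrow> ennreal" where
  "first_return e h b = step (suspension e h) e b"

primrec pull :: "'e list \<Rightarrow> 'b \<Rightarrow> 'b" where
  "pull [] b = b"
| "pull (x # w) b = pull w (s x b)"

lemma step_mono: "(\<And>f'. m f' (s f' b) \<le> m' f' (s f' b)) \<Longrightarrow> step m f b \<le> step m' f b"
  unfolding step_def by (intro nn_integral_mono mult_left_mono) auto

lemma step_suminf: "step (\<lambda>f b. \<Sum>n. m n f b) f b = (\<Sum>n. step (m n) f b)"
  unfolding step_def ennreal_suminf_cmult[symmetric] by (rule nn_integral_suminf) simp

lemma step_sum: "step (\<lambda>f b. \<Sum>n<N. m n f b) f b = (\<Sum>n<(N::nat). step (m n) f b)"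
  unfolding step_def sum_distrib_left by (rule nn_integral_sum) simp

lemma step_add: "step (\<lambda>f b. m f b + m' f b) f b = step m f b + step m' f b"
  unfolding step_def distrib_left by (rule nn_integral_add) auto

lemma step_cmult: "step (\<lambda>f b. c * m f b) f b = c * step m f b"
  unfolding step_def by (subst nn_integral_cmult[symmetric]) (auto simp: mult.left_commute)

lemma step_excursion_path_aux:
  assumes "\<And>f b. excursion e h n f b =
    (\<integral>\<^sup>+w. (if hd w = f \<and> e \<notin> set (butlast w) then h (pull (tl w) b) else 0) \<partial>path_pmf K e n)"
  shows "step (excursion e h n) f b =
    (\<integral>\<^sup>+w. (if hd w = f \<and> e \<notin> set (butlast (tl w)) then h (pull (tl w) b) else 0) \<partial>path_pmf K e (Suc n))"
proof -
  let ?P = "path_pmf K e n"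
  let ?\<phi> = "\<lambda>w b. if e \<notin> set (butlast w) then h (pull (tl w) b) else 0"
  have "step (excursion e h n) f b =
      (\<integral>\<^sup>+f'. (\<integral>\<^sup>+w. (if f' = hd w then ennreal (pmf (K f') f) * ?\<phi> w (s f' b) else 0) \<partial>?P) \<partial>count_space UNIV)"
    unfolding step_def assms
    by (intro nn_integral_cong) (subst nn_integral_cmult[symmetric], auto intro!: nn_integral_cong)
  also have "\<dots> = (\<integral>\<^sup>+w. (\<integral>\<^sup>+f'. (if f' = hd w then ennreal (pmf (K f') f) * ?\<phi> w (s f' b) else 0) \<partial>count_space UNIV) \<partial>?P)"
    by (rule nn_integral_count_space_nn_integral[symmetric]) auto
  also have "\<dots> = (\<integral>\<^sup>+w. ennreal (pmf (K (hd w)) f) * ?\<phi> w (s (hd w) b) \<partial>?P)"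
    by (simp only: nn_integral_count_space_delta)
  also have "\<dots> = (\<integral>\<^sup>+w. (\<integral>\<^sup>+x. (if x = f then (if e \<notin> set (butlast w) then h (pull w b) else 0) else 0) \<partial>K (hd w)) \<partial>?P)"
  proof (intro nn_integral_cong_AE AE_pmfI)
    fix w assume "w \<in> set_pmf ?P"
    then obtain y v where "w = y # v"
      by (cases w) (auto dest: path_pmf_nonempty)
    then show "ennreal (pmf (K (hd w)) f) * ?\<phi> w (s (hd w) b) =
        (\<integral>\<^sup>+x. (if x = f then (if e \<notin> set (butlast w) then h (pull w b) else 0) else 0) \<partial>K (hd w))"
      unfolding nn_integral_pmf_delta by simp
  qed
  also have "\<dots> = (\<integral>\<^sup>+w. (if hd w = f \<and> e \<notin> set (butlast (tl w)) then h (pull (tl w) b) else 0) \<partial>path_pmf K e (Suc n))"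
    by (auto intro!: nn_integral_cong)
  finally show ?thesis .
qed

lemma excursion_path:
  "excursion e h n f b =
    (\<integral>\<^sup>+w. (if hd w = f \<and> e \<notin> set (butlast w) then h (pull (tl w) b) else 0) \<partial>path_pmf K e n)"
proof (induction n arbitrary: f b)
  case (Suc n)
  show ?case
  proof (cases "f = e")
    case True
    have "(if hd w = f \<and> e \<notin> set (butlast w) then h (pull (tl w) b) else 0) = 0"
      if "w \<in> set_pmf (path_pmf K e (Suc n))" for w
      using that True by (auto dest: path_pmf_nonempty)
    then have "(\<integral>\<^sup>+w. (if hd w = f \<and> e \<notin> set (butlast w) then h (pull (tl w) b) else 0) \<partial>path_pmf K e (Suc n)) =
        (\<integral>\<^sup>+w. 0 \<partial>path_pmf K e (Suc n))"
      by (intro nn_integral_cong_AE AE_pmfI) blast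
    then show ?thesis
      using True by simp
  next
    case False
    have eq: "(if hd w = f \<and> e \<notin> set (butlast w) then h (pull (tl w) b) else 0) =
        (if hd w = f \<and> e \<notin> set (butlast (tl w)) then h (pull (tl w) b) else 0)"
      if "w \<in> set_pmf (path_pmf K e (Suc n))" for w
      using that False by (auto dest: path_pmf_nonempty)
    show ?thesis
      using False step_excursion_path_aux[of e h n f b, OF Suc.IH]
      by (simp only: excursion.simps if_False) (intro nn_integral_cong_AE AE_pmfI eq[symmetric])
  qed
qed auto

lemmas step_excursion_path = step_excursion_path_aux[OF excursion_path]

lemma first_return_suminf: "first_return e h b = (\<Sum>n. step (excursion e h n) e b)"
  unfolding first_return_def suspension_def by (rule step_suminf)

lemma first_return_path:
  "first_return e h b = (\<integral>\<^sup>+\<omega>. (if return_time e \<omega> < \<infinity>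
     then h (pull (rev (map \<omega> [0..<the_enat (return_time e \<omega>)])) b) else 0) \<partial>markov_measure K e)"
proof -
  let ?\<phi> = "\<lambda>n \<omega>. if return_time e \<omega> = enat (Suc n) then h (pull (rev (map \<omega> [0..<Suc n])) b) else 0"
  let ?\<psi> = "\<lambda>w. if hd w = e \<and> e \<notin> set (butlast (tl w)) then h (pull (tl w) b) else 0"
  have \<psi>: "?\<psi> (rev (map \<omega> [0..<Suc (Suc n)])) = ?\<phi> n \<omega>" for n \<omega>
  proof -
    have "butlast (rev (map \<omega> [0..<Suc n])) = rev (map \<omega> [Suc 0..<Suc n])"
      by (subst upt_conv_Cons) (auto simp del: upt_Suc)
    then have "e \<notin> set (butlast (rev (map \<omega> [0..<Suc n]))) \<longleftrightarrow> (\<forall>k. 1 \<le> k \<and> k < Suc n \<longrightarrow> \<omega> k \<noteq> e)"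
      by (auto simp del: upt_Suc)
    moreover have "tl (rev (map \<omega> [0..<Suc (Suc n)])) = rev (map \<omega> [0..<Suc n])"
      "hd (rev (map \<omega> [0..<Suc (Suc n)])) = \<omega> (Suc n)"
      by simp_all
    ultimately show ?thesis
      unfolding return_time_eq_enat_iff by (simp only: le_add1 plus_1_eq_Suc conj_ac simp_thms) auto
  qed
  have "first_return e h b = (\<Sum>n. (\<integral>\<^sup>+\<omega>. ?\<phi> n \<omega> \<partial>markov_measure K e))"
    unfolding first_return_suminf step_excursion_path nn_integral_path_pmf \<psi> ..
  also have "\<dots> = (\<integral>\<^sup>+\<omega>. (\<Sum>n. ?\<phi> n \<omega>) \<partial>markov_measure K e)"
  proof (rule nn_integral_suminf[symmetric])
    fix n
    have "(\<lambda>\<omega>. ?\<psi> (rev (map \<omega> [0..<Suc (Suc n)]))) \<in> borel_measurable (markov_measure K e)"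
      by (rule measurable_compose[OF measurable_word_markov]) simp
    then show "?\<phi> n \<in> borel_measurable (markov_measure K e)"
      unfolding \<psi> .
  qed
  also have "\<dots> = (\<integral>\<^sup>+\<omega>. (if return_time e \<omega> < \<infinity>
     then h (pull (rev (map \<omega> [0..<the_enat (return_time e \<omega>)])) b) else 0) \<partial>markov_measure K e)"
  proof (rule nn_integral_cong)
    fix \<omega>
    show "(\<Sum>n. ?\<phi> n \<omega>) = (if return_time e \<omega> < \<infinity>
        then h (pull (rev (map \<omega> [0..<the_enat (return_time e \<omega>)])) b) else 0)"
    proof (cases "return_time e \<omega>")
      case (enat k)
      then obtain j where j: "k = Suc j"
        using return_time_eq_enat_iff[of e \<omega> k] by (cases k) auto
      have "(\<Sum>n. ?\<phi> n \<omega>) = (\<Sum>n. if n = j then h (pull (rev (map \<omega> [0..<Suc n])) b) else 0)"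
        by (intro suminf_cong) (auto simp: enat j)
      also have "\<dots> = h (pull (rev (map \<omega> [0..<Suc j])) b)"
        by (rule sums_unique[symmetric, OF sums_single])
      finally show ?thesis
        by (simp add: enat j del: upt_Suc)
    qed simp
  qed
  finally show ?thesis .
qed

lemma excursion_cmult: "excursion e (\<lambda>b. c * h b) n f b = c * excursion e h n f b"
proof (induction n arbitrary: f b)
  case (Suc n)
  then have "excursion e (\<lambda>b. c * h b) n = (\<lambda>f b. c * excursion e h n f b)"
    by (intro ext)
  then show ?case by (simp add: step_cmult)
qed simp

lemma excursion_add: "excursion e (\<lambda>b. h b + h' b) n f b = excursion e h n f b + excursion e h' n f b"
proof (induction n arbitrary: f b)
  case (Suc n)
  then have "excursion e (\<lambda>b. h b + h' b) n = (\<lambda>f b. excursion e h n f b + excursion e h' n f b)"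
    by (intro ext)
  then show ?case by (simp add: step_add)
qed simp

lemma suspension_cmult: "suspension e (\<lambda>b. c * h b) f b = c * suspension e h f b"
  unfolding suspension_def excursion_cmult by simp

lemma suspension_add: "suspension e (\<lambda>b. h b + h' b) f b = suspension e h f b + suspension e h' f b"
  unfolding suspension_def excursion_add by (rule suminf_add[symmetric]) auto

lemma suspension_self [simp]: "suspension e h e b = h b"
proof -
  have "excursion e h n e b = (if n = 0 then h b else 0)" for n
    by (cases n) auto
  then have "suspension e h e b = (\<Sum>n. if n = 0 then (\<lambda>_. h b) n else 0)"
    unfolding suspension_def by simp
  also have "\<dots> = h b"
    by (rule sums_unique[symmetric, OF sums_single])
  finally show ?thesis .
qed

lemma step_cong: "(\<And>f'. m f' (s f' b) = m' f' (s f' b)) \<Longrightarrow> step m f b = step m' f b"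
  unfolding step_def by simp

lemma suspension_cong:
  assumes s: "\<And>x b. b \<in> B \<Longrightarrow> s x b \<in> B" and h: "\<And>b. b \<in> B \<Longrightarrow> h b = h' b" and "b \<in> B"
  shows "suspension e h f b = suspension e h' f b"
proof -
  have "excursion e h n f b = excursion e h' n f b" for n
    using \<open>b \<in> B\<close>
  proof (induction n arbitrary: f b)
    case (Suc n)
    then show ?case
      using s by (auto intro!: step_cong)
  qed (simp add: h)
  then show ?thesis
    unfolding suspension_def by simp
qed

lemma first_return_cong:
  assumes s: "\<And>x b. b \<in> B \<Longrightarrow> s x b \<in> B" and h: "\<And>b. b \<in> B \<Longrightarrow> h b = h' b" and "b \<in> B"
  shows "first_return e h b = first_return e h' b"
  unfolding first_return_def using assms(3) s by (intro step_cong suspension_cong[OF s h]) auto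

lemma first_return_cmult: "first_return e (\<lambda>b. c * h b) b = c * first_return e h b"
proof -
  have "suspension e (\<lambda>b. c * h b) = (\<lambda>f b. c * suspension e h f b)"
    by (intro ext suspension_cmult)
  then show ?thesis
    unfolding first_return_def by (simp add: step_cmult)
qed

lemma suspension_fixed:
  assumes "\<And>x. s x b = b"
  shows "suspension e h f b = h b * suspension e (\<lambda>_. 1) f b"
proof -
  have "suspension e h f b = suspension e (\<lambda>c. h b * (\<lambda>_. 1) c) f b"
    using assms by (intro suspension_cong[of "{b}"]) auto
  then show ?thesis
    unfolding suspension_cmult .
qed

lemma step_suspension:
  "step (suspension e h) f b = (if f = e then first_return e h b else suspension e h f b)"
proof (cases "f = e")
  case False
  then have "step (suspension e h) f b = (\<Sum>n. excursion e h (Suc n) f b)"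
    unfolding suspension_def step_suminf by simp
  also have "\<dots> = suspension e h f b"
    using suminf_offset[of "\<lambda>n. excursion e h n f b" 1] False unfolding suspension_def by simp
  finally show ?thesis
    using False by simp
qed (simp add: first_return_def)

lemma suspension_le:
  assumes s: "\<And>x b. b \<in> B \<Longrightarrow> s x b \<in> B"
    and m: "\<And>f b. b \<in> B \<Longrightarrow> step m f b \<le> m f b" and "b \<in> B"
  shows "suspension e (m e) f b \<le> m f b"
  unfolding suspension_def
proof (rule suminf_le_const)
  show "(\<Sum>n<N. excursion e (m e) n f b) \<le> m f b" for N
    using \<open>b \<in> B\<close>
  proof (induction N arbitrary: f b)
    case (Suc N)
    show ?case
    proof (cases "f = e")
      case False
      then have "(\<Sum>n<Suc N. excursion e (m e) n f b) = step (\<lambda>f b. \<Sum>n<N. excursion e (m e) n f b) f b"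
        unfolding sum.lessThan_Suc_shift step_sum by simp
      also have "\<dots> \<le> step m f b"
        using Suc s by (intro step_mono) auto
      also have "\<dots> \<le> m f b"
        using m Suc.prems .
      finally show ?thesis .
    qed (simp add: sum.lessThan_Suc_shift del: sum.lessThan_Suc)
  qed simp
qed simp

lemma pull_append: "pull (v @ w) b = pull w (pull v b)"
  by (induction v arbitrary: b) auto

lemma pull_closed: "(\<And>x b. b \<in> B \<Longrightarrow> s x b \<in> B) \<Longrightarrow> b \<in> B \<Longrightarrow> pull w b \<in> B"
  by (induction w arbitrary: b) auto

lemma pull_fixed: "(\<And>x. s x b = b) \<Longrightarrow> pull w b = b"
  by (induction w) auto

lemma admissible_le:
  assumes s: "\<And>x b. b \<in> B \<Longrightarrow> s x b \<in> B" and "admissible K f e w"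
  shows "\<exists>c. c \<noteq> 0 \<and> (\<forall>m. (\<forall>f. \<forall>b\<in>B. step m f b \<le> m f b) \<longrightarrow> (\<forall>b\<in>B. c * m e (pull w b) \<le> m f b))"
  using assms(2)
proof (induction w arbitrary: f)
  case (Cons x w)
  let ?p = "ennreal (pmf (K x) f)"
  have p: "?p \<noteq> 0"
    using Cons.prems by (auto simp: admissible_Cons)
  have *: "?p * m x (s x b) \<le> m f b" if "\<forall>f. \<forall>b\<in>B. step m f b \<le> m f b" "b \<in> B" for m b
  proof -
    have "?p * m x (s x b) =
        (\<integral>\<^sup>+f'. (if f' = x then ennreal (pmf (K f') f) * m f' (s f' b) else 0) \<partial>count_space UNIV)"
      by (simp only: nn_integral_count_space_delta)
    also have "\<dots> \<le> step m f b"
      unfolding step_def by (intro nn_integral_mono) auto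
    finally show ?thesis
      using that by (meson order_trans)
  qed
  show ?case
  proof (cases "w = []")
    case True
    then have "x = e"
      using Cons.prems by (auto simp: admissible_Cons)
    with True p * show ?thesis
      by (intro exI[of _ ?p]) auto
  next
    case False
    then have "admissible K x e w"
      using Cons.prems by (auto simp: admissible_Cons)
    from Cons.IH[OF this] obtain c where c: "c \<noteq> 0"
      "\<And>m b. \<forall>f. \<forall>b\<in>B. step m f b \<le> m f b \<Longrightarrow> b \<in> B \<Longrightarrow> c * m e (pull w b) \<le> m x b"
      by blast
    have "?p * c * m e (pull (x # w) b) \<le> m f b" if m: "\<forall>f. \<forall>b\<in>B. step m f b \<le> m f b" "b \<in> B" for m b
    proof -
      have "?p * (c * m e (pull w (s x b))) \<le> ?p * m x (s x b)"
        using c(2)[OF m(1) s[OF m(2)]] by (rule mult_left_mono) simp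
      with *[OF m] show ?thesis
        by (simp add: mult.assoc)
    qed
    with p c(1) show ?thesis
      by (intro exI[of _ "?p * c"]) auto
  qed
qed simp

end

locale recurrent_pullback_chain = pullback_chain K s
  for K :: "'e::countable \<Rightarrow> 'e pmf" and s :: "'e \<Rightarrow> 'b \<Rightarrow> 'b" +
  assumes irreducible: "irreducible_chain K"
    and AE_return: "\<And>e. AE \<omega> in markov_measure K e. return_time e \<omega> < \<infinity>"
begin

lemma first_return_recurrent:
  "first_return e h b =
    (\<integral>\<^sup>+\<omega>. h (pull (rev (map \<omega> [0..<the_enat (return_time e \<omega>)])) b) \<partial>markov_measure K e)"
  unfolding first_return_path
proof (rule nn_integral_cong_AE)
  show "AE \<omega> in markov_measure K e. (if return_time e \<omega> < \<infinity>
      then h (pull (rev (map \<omega> [0..<the_enat (return_time e \<omega>)])) b) else 0) =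
      h (pull (rev (map \<omega> [0..<the_enat (return_time e \<omega>)])) b)"
    using AE_return[of e] by (rule eventually_mono) simp
qed

lemma first_return_fixed: "(\<And>x. s x b = b) \<Longrightarrow> first_return e h b = h b"
  unfolding first_return_recurrent
  by (simp add: pull_fixed prob_space.emeasure_space_1[OF prob_space_markov_measure, simplified])

lemma stationary_fixed_eq_suspension:
  assumes fixed: "\<And>x. s x b = b"
    and m: "\<And>f. step m f b = m f b" and fin: "(\<integral>\<^sup>+f. m f b \<partial>count_space UNIV) < \<infinity>"
  shows "m f b = suspension e (m e) f b"
proof -
  let ?S = "suspension e (m e)"
  let ?d = "\<lambda>f (_ :: 'b). m f b - ?S f b"
  have le: "?S f b \<le> m f b" for f
    using fixed m by (intro suspension_le[of "{b}"]) auto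
  have mfin: "m f b < \<infinity>" for f
  proof -
    have "m f b = (\<integral>\<^sup>+f'. (if f' = f then m f' b else 0) \<partial>count_space UNIV)"
      by (simp only: nn_integral_count_space_delta)
    also have "\<dots> \<le> (\<integral>\<^sup>+f'. m f' b \<partial>count_space UNIV)"
      by (intro nn_integral_mono) auto
    finally show ?thesis using fin by order
  qed
  have S: "step ?S f b = ?S f b" for f
    unfolding step_suspension by (auto simp: first_return_fixed[OF fixed])
  have "step ?d f c = ?d f c" for f c
  proof -
    have "step ?d f c = (\<integral>\<^sup>+f'. ennreal (pmf (K f') f) * m f' (s f' b) - ennreal (pmf (K f') f) * ?S f' (s f' b) \<partial>count_space UNIV)"
      unfolding step_def fixed by (intro nn_integral_cong) (simp add: ennreal_right_diff_distrib)
    also have "\<dots> = step m f b - step ?S f b"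
      unfolding step_def
    proof (rule nn_integral_diff)
      show "(\<integral>\<^sup>+f'. ennreal (pmf (K f') f) * ?S f' (s f' b) \<partial>count_space UNIV) \<noteq> \<infinity>"
        using S[of f] le[of f] mfin[of f] unfolding step_def by (auto simp: top_unique)
      show "AE f' in count_space UNIV. ennreal (pmf (K f') f) * ?S f' (s f' b) \<le> ennreal (pmf (K f') f) * m f' (s f' b)"
        unfolding fixed using le by (intro AE_I2 mult_left_mono) auto
    qed auto
    finally show ?thesis unfolding m S .
  qed
  then have d: "\<forall>f. \<forall>c\<in>UNIV. step ?d f c \<le> ?d f c" by simp
  obtain w where "admissible K e f w"
    using irreducible_chain_admissible[OF irreducible] .
  from admissible_le[of UNIV, OF _ this] d obtain c where "c \<noteq> 0" "c * ?d f (pull w b) \<le> ?d e b"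
    by blast
  then have "?d f b = 0"
    using mfin[of e] by simp
  then have "m f b \<le> ?S f b"
    using ennreal_minus_eq_0 by blast
  then show ?thesis using le[of f] by simp
qed

end


section \<open>Borel measurability of the action\<close>

lemma space_borel_of [simp]: "space (borel_of T) = topspace T"
  unfolding borel_of_def by (rule space_measure_of) (auto dest: openin_subset)

lemma openin_sets_borel_of: "openin T U \<Longrightarrow> U \<in> sets (borel_of T)"
  unfolding borel_of_def by (rule in_measure_of) (auto dest: openin_subset)

lemma topspace_sets_borel_of [simp]: "topspace T \<in> sets (borel_of T)"
  by (simp add: openin_sets_borel_of)

lemma sets_borel_of_subset: "A \<in> sets (borel_of T) \<Longrightarrow> A \<subseteq> topspace T"
  using sets.sets_into_space by fastforce

lemma measurable_borel_ofI:
  assumes "\<And>x. x \<in> space M \<Longrightarrow> f x \<in> topspace Y"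
    and "\<And>U. openin Y U \<Longrightarrow> f -` U \<inter> space M \<in> sets M"
  shows "f \<in> measurable M (borel_of Y)"
  unfolding borel_of_def using assms by (intro measurable_measure_of) (auto dest: openin_subset)

lemma openin_prod_topology_sets:
  assumes "second_countable X" and W: "openin (prod_topology T X) W"
  shows "W \<in> sets (borel_of T \<Otimes>\<^sub>M borel_of X)"
proof -
  obtain \<B> where \<B>: "countable \<B>" "\<And>V. V \<in> \<B> \<Longrightarrow> openin X V"
    "\<And>U x. openin X U \<Longrightarrow> x \<in> U \<Longrightarrow> \<exists>V \<in> \<B>. x \<in> V \<and> V \<subseteq> U"
    using assms(1) by (auto simp: second_countable_def)
  define R where "R V = \<Union>{U. openin T U \<and> U \<times> V \<subseteq> W}" for V
  have R: "openin T (R V)" for V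
    unfolding R_def by (rule openin_Union) auto
  have "W = (\<Union>V\<in>\<B>. R V \<times> V)"
  proof
    show "W \<subseteq> (\<Union>V\<in>\<B>. R V \<times> V)"
    proof
      fix z assume "z \<in> W"
      then obtain U V where UV: "openin T U" "openin X V" "fst z \<in> U" "snd z \<in> V" "U \<times> V \<subseteq> W"
        using W by (cases z) (force simp: openin_prod_topology_alt)
      then obtain V' where "V' \<in> \<B>" "snd z \<in> V'" "V' \<subseteq> V"
        using \<B>(3) by blast
      moreover from this have "U \<times> V' \<subseteq> W"
        using UV by blast
      ultimately show "z \<in> (\<Union>V\<in>\<B>. R V \<times> V)"
        using UV unfolding R_def by (cases z) auto
    qed
  qed (auto simp: R_def)
  moreover have "R V \<times> V \<in> sets (borel_of T \<Otimes>\<^sub>M borel_of X)" if "V \<in> \<B>" for V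
    using that R \<B>(2) by (intro pair_measureI openin_sets_borel_of)
  then have "(\<Union>V\<in>\<B>. R V \<times> V) \<in> sets (borel_of T \<Otimes>\<^sub>M borel_of X)"
    by (intro sets.countable_UN'[OF \<B>(1)]) auto
  ultimately show ?thesis
    by (simp only:)
qed

lemma measurable_continuous_prod:
  assumes "second_countable X" and f: "continuous_map (prod_topology T X) Y f"
  shows "f \<in> measurable (borel_of T \<Otimes>\<^sub>M borel_of X) (borel_of Y)"
proof (rule measurable_borel_ofI)
  fix U assume "openin Y U"
  then have "openin (prod_topology T X) {z \<in> topspace (prod_topology T X). f z \<in> U}"
    using f by (simp only: openin_continuous_map_preimage)
  moreover have "{z \<in> topspace (prod_topology T X). f z \<in> U} = f -` U \<inter> space (borel_of T \<Otimes>\<^sub>M borel_of X)"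
    by (auto simp: space_pair_measure)
  ultimately show "f -` U \<inter> space (borel_of T \<Otimes>\<^sub>M borel_of X) \<in> sets (borel_of T \<Otimes>\<^sub>M borel_of X)"
    using openin_prod_topology_sets[OF assms(1)] by metis
qed (use f in \<open>auto simp: continuous_map_def space_pair_measure\<close>)


section \<open>The action chain\<close>

locale action_chain =
  fixes G :: "('g, 'm) monoid_scheme" and T :: "'g topology"
    and X :: "'x topology" and act :: "'g \<Rightarrow> 'x \<Rightarrow> 'x"
    and g :: "'e::countable \<Rightarrow> 'g" and K :: "'e \<Rightarrow> 'e pmf"
  assumes group: "group G" and topspace_T: "topspace T = carrier G"
    and second_countable: "second_countable X"
    and action: "continuous_action G T X act"
    and g_carrier: "g e \<in> carrier G"
    and irred: "irreducible_chain K" and pos_rec: "positive_recurrent K"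
begin

definition preimage :: "'e \<Rightarrow> 'x set \<Rightarrow> 'x set" where
  "preimage e A = act (g e) -` A \<inter> topspace X"

sublocale group G
  by (rule group)

sublocale group_action G "topspace X" act
  using action unfolding continuous_action_def by simp

sublocale recurrent_pullback_chain K preimage
  using irred positive_recurrent_AE_return[OF pos_rec] by unfold_locales

lemma act_closed: "h \<in> carrier G \<Longrightarrow> x \<in> topspace X \<Longrightarrow> act h x \<in> topspace X"
  using element_image by blast

lemma measurable_act_pair: "(\<lambda>(h, x). act h x) \<in> measurable (borel_of T \<Otimes>\<^sub>M borel_of X) (borel_of X)"
  using action unfolding continuous_action_def by (intro measurable_continuous_prod second_countable) simp

lemma measurable_act [measurable]:
  assumes "h \<in> carrier G"
  shows "act h \<in> measurable (borel_of X) (borel_of X)"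
  using measurable_compose[OF measurable_Pair1' measurable_act_pair] assms topspace_T by simp

lemma word_prod_Nil [simp]: "word_prod G g [] = \<one>\<^bsub>G\<^esub>"
  and word_prod_Cons [simp]: "word_prod G g (x # w) = g x \<otimes>\<^bsub>G\<^esub> word_prod G g w"
  by (simp_all add: word_prod_def)

lemma word_prod_closed [simp]: "word_prod G g w \<in> carrier G"
  by (induction w) (auto simp: g_carrier)

lemma word_prod_append: "word_prod G g (v @ w) = word_prod G g v \<otimes>\<^bsub>G\<^esub> word_prod G g w"
  by (induction v) (auto simp: g_carrier m_assoc)

lemma preimage_sets: "A \<in> sets (borel_of X) \<Longrightarrow> preimage e A \<in> sets (borel_of X)"
  unfolding preimage_def using measurable_sets[OF measurable_act[OF g_carrier]] by simp

lemma preimage_topspace: "preimage e (topspace X) = topspace X"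
  unfolding preimage_def using act_closed[OF g_carrier] by auto

lemma pull_eq_vimage:
  assumes "A \<subseteq> topspace X"
  shows "pull w A = act (word_prod G g w) -` A \<inter> topspace X"
  using assms
proof (induction w arbitrary: A)
  case Nil
  then show ?case by (auto simp: id_eq_one[symmetric])
next
  case (Cons x w)
  have "preimage x A \<subseteq> topspace X"
    by (auto simp: preimage_def)
  then have "pull (x # w) A = act (word_prod G g w) -` preimage x A \<inter> topspace X"
    by (simp add: Cons.IH)
  also have "\<dots> = act (word_prod G g (x # w)) -` A \<inter> topspace X"
    using g_carrier act_closed by (auto simp: preimage_def composition_rule)
  finally show ?case .
qed

lemma emeasure_pushforward:
  assumes "sets \<eta> = sets (borel_of X)" "h \<in> carrier G" "A \<in> sets (borel_of X)"
  shows "emeasure (pushforward X (act h) \<eta>) A = emeasure \<eta> (act h -` A \<inter> topspace X)"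
  using assms by (subst emeasure_distr)
    (auto simp: measurable_cong_sets[OF assms(1) refl] sets_eq_imp_space_eq[OF assms(1)] measurable_act)

lemma measurable_return_word:
  "(\<lambda>\<omega>. rev (map \<omega> [0..<the_enat (return_time e \<omega>)])) \<in> measurable (markov_measure K e) (count_space UNIV)"
proof -
  have "the_enat (return_time e \<omega>) =
      (if \<exists>n. 1 \<le> n \<and> \<omega> n = e then LEAST n. 1 \<le> n \<and> \<omega> n = e else the_enat \<infinity>)" for \<omega>
  proof (cases "\<exists>n. 1 \<le> n \<and> \<omega> n = e")
    case True
    then have "return_time e \<omega> = enat (LEAST n. 1 \<le> n \<and> \<omega> n = e)"
      unfolding return_time_eq_enat_iff using LeastI_ex[OF True] not_less_Least by blast
    with True show ?thesis by simp
  next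
    case False
    then have "return_time e \<omega> = \<infinity>"
      using return_time_less_top_iff[of e \<omega>] by auto
    then show ?thesis unfolding if_not_P[OF False] by (rule arg_cong)
  qed
  then have "(\<lambda>\<omega>. the_enat (return_time e \<omega>)) \<in> measurable (markov_measure K e) (count_space UNIV)"
    by simp
  then show ?thesis
    by (rule measurable_compose_countable[rotated]) (rule measurable_word_markov)
qed

lemma measurable_return_prod:
  "(\<lambda>\<omega>. word_prod G g (rev (map \<omega> [0..<the_enat (return_time e \<omega>)]))) \<in>
    measurable (markov_measure K e) (borel_of T)"
  using measurable_compose[OF measurable_return_word, of "word_prod G g" "borel_of T"]
  by (simp add: topspace_T)

lemma nn_integral_renewal_measure:
  assumes \<eta>: "prob_space \<eta>" "sets \<eta> = sets (borel_of X)" and A: "A \<in> sets (borel_of X)"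
  shows "(\<integral>\<^sup>+h. emeasure (pushforward X (act h) \<eta>) A \<partial>renewal_measure G T g K e) = first_return e (emeasure \<eta>) A"
proof -
  interpret prob_space \<eta> by fact
  let ?S = "(\<lambda>(h, x). act h x) -` A \<inter> space (borel_of T \<Otimes>\<^sub>M borel_of X)"
  have S: "?S \<in> sets (borel_of T \<Otimes>\<^sub>M \<eta>)"
    using measurable_sets[OF measurable_act_pair A] sets_pair_measure_cong[OF refl \<eta>(2)] by blast
  have "(\<lambda>h. emeasure \<eta> (Pair h -` ?S)) \<in> borel_measurable (borel_of T)"
    using S by (rule measurable_emeasure_Pair)
  moreover have "emeasure \<eta> (Pair h -` ?S) = emeasure (pushforward X (act h) \<eta>) A" if "h \<in> space (borel_of T)" for h
  proof -
    have "h \<in> carrier G" using that topspace_T by simp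
    moreover have "Pair h -` ?S = act h -` A \<inter> topspace X"
      using that by (auto simp: space_pair_measure)
    ultimately show ?thesis
      using emeasure_pushforward[OF \<eta>(2) _ A] by simp
  qed
  ultimately have m: "(\<lambda>h. emeasure (pushforward X (act h) \<eta>) A) \<in> borel_measurable (borel_of T)"
    by (subst measurable_cong[where g = "\<lambda>h. emeasure \<eta> (Pair h -` ?S)"]) auto
  then show ?thesis
    unfolding renewal_measure_def first_return_recurrent pull_eq_vimage[OF sets_borel_of_subset[OF A]]
    using emeasure_pushforward[OF \<eta>(2) _ A]
    by (subst nn_integral_distr[OF measurable_return_prod]) auto
qed

lemma convolution_stationary_iff:
  "\<eta> \<in> convolution_stationary_probs X act (renewal_measure G T g K e) \<longleftrightarrow>
    prob_space \<eta> \<and> sets \<eta> = sets (borel_of X) \<and>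
    (\<forall>A\<in>sets (borel_of X). emeasure \<eta> A = first_return e (emeasure \<eta>) A)"
  unfolding convolution_stationary_probs_def using nn_integral_renewal_measure by auto

lemma return_word_in_support:
  assumes w: "admissible K e e w" "e \<notin> set (butlast w)"
  shows "word_prod G g w \<in> measure_support T (renewal_measure G T g K e)"
  unfolding measure_support_def
proof (intro CollectI conjI allI impI)
  fix U assume U: "openin T U \<and> word_prod G g w \<in> U"
  let ?M = "markov_measure K e" and ?n = "length w"
  let ?W = "\<lambda>\<omega>. word_prod G g (rev (map \<omega> [0..<the_enat (return_time e \<omega>)]))"
  let ?L = "\<lambda>\<omega> :: nat \<Rightarrow> 'e. rev (map \<omega> [0..<Suc ?n])"
  have ne: "w \<noteq> []" using w by auto
  have L: "?W \<omega> = word_prod G g w" if "?L \<omega> = e # w" for \<omega>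
  proof -
    have 1: "\<omega> ?n = e" "rev (map \<omega> [0..<?n]) = w"
      using that by simp_all
    have "set (butlast w) = \<omega> ` {1..<?n}"
    proof -
      have "butlast (rev (map \<omega> [0..<?n])) = rev (map \<omega> [Suc 0..<?n])"
        using ne by (subst upt_conv_Cons) auto
      then show ?thesis unfolding 1(2) by simp
    qed
    then have "\<omega> k \<noteq> e" if "1 \<le> k" "k < ?n" for k
      using w(2) that by force
    then have "return_time e \<omega> = enat ?n"
      using ne 1(1) unfolding return_time_eq_enat_iff by (simp add: Suc_le_eq)
    with 1(2) show ?thesis by simp
  qed
  have "0 < ennreal (pmf (path_pmf K e ?n) (e # w))"
    using path_of_admissible[OF w(1)] by (simp add: pmf_positive_iff)
  also have "\<dots> = emeasure (path_pmf K e ?n) {e # w}"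
    by (simp add: emeasure_pmf_single)
  also have "\<dots> = emeasure ?M (?L -` {e # w} \<inter> space ?M)"
    unfolding distr_markov_measure_path[symmetric] by (rule emeasure_distr[OF measurable_word_markov]) simp
  also have "\<dots> \<le> emeasure ?M (?W -` U \<inter> space ?M)"
    using L U measurable_sets[OF measurable_return_prod openin_sets_borel_of] by (intro emeasure_mono) auto
  also have "\<dots> = emeasure (renewal_measure G T g K e) U"
    unfolding renewal_measure_def using U openin_sets_borel_of by (subst emeasure_distr[OF measurable_return_prod]) auto
  finally show "0 < emeasure (renewal_measure G T g K e) U" .
qed (simp add: topspace_T)

lemma loop_in_renewal_semigroup:
  "admissible K e e w \<Longrightarrow> word_prod G g w \<in> renewal_semigroup G T g K e"
proof (induction "length w" arbitrary: w rule: less_induct)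
  case less
  have support_subset: "measure_support T (renewal_measure G T g K e) \<subseteq> renewal_semigroup G T g K e"
    unfolding renewal_semigroup_def by (rule hull_subset)
  show ?case
  proof (cases "e \<in> set (butlast w)")
    case False
    with less.prems have "word_prod G g w \<in> measure_support T (renewal_measure G T g K e)"
      by (rule return_word_in_support)
    then show ?thesis
      by (rule subsetD[OF support_subset])
  next
    case True
    from split_list_first[OF this] obtain u v where uv: "butlast w = u @ e # v" "e \<notin> set u"
      by blast
    define b where "b = v @ [last w]"
    have "w \<noteq> []"
      using True by auto
    then have w: "w = (u @ [e]) @ b"
      using uv(1) append_butlast_last_id[of w] by (simp add: b_def)
    then have a: "admissible K e e (u @ [e])" and b: "admissible K e e b"
      using less.prems admissible_append[of "u @ [e]" b K e e] by (auto simp: b_def)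
    have "word_prod G g (u @ [e]) \<in> measure_support T (renewal_measure G T g K e)"
      using a uv(2) by (intro return_word_in_support) auto
    then have "word_prod G g (u @ [e]) \<in> renewal_semigroup G T g K e"
      by (rule subsetD[OF support_subset])
    moreover have "word_prod G g b \<in> renewal_semigroup G T g K e"
      using b w by (intro less.hyps) auto
    moreover have "word_prod G g w = word_prod G g (u @ [e]) \<otimes>\<^bsub>G\<^esub> word_prod G g b"
      unfolding w by (rule word_prod_append)
    ultimately show ?thesis
      unfolding renewal_semigroup_def hull_def closed_subsemigroup_def by simp
  qed
qed

abbreviation product_sigma :: "('e \<times> 'x) measure" where
  "product_sigma \<equiv> count_space UNIV \<Otimes>\<^sub>M borel_of X"

definition fiber :: "('e \<times> 'x) measure \<Rightarrow> 'e \<Rightarrow> 'x set \<Rightarrow> ennreal" where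
  "fiber N f A = emeasure N ({f} \<times> A)"

definition glue :: "('e \<Rightarrow> 'x set \<Rightarrow> ennreal) \<Rightarrow> ('e \<times> 'x) measure" where
  "glue m = measure_of (space product_sigma) (sets product_sigma)
     (\<lambda>B. \<integral>\<^sup>+f. m f (Pair f -` B) \<partial>count_space UNIV)"

lemma space_product_sigma: "space product_sigma = UNIV \<times> topspace X"
  by (simp add: space_pair_measure)

lemma fiber_set: "A \<in> sets (borel_of X) \<Longrightarrow> {f} \<times> A \<in> sets product_sigma"
  by (rule pair_measureI) auto

lemma slice_set: "B \<in> sets product_sigma \<Longrightarrow> Pair f -` B \<in> sets (borel_of X)"
  by (rule sets_Pair1)

lemma emeasure_eq_fibers:
  assumes N: "sets N = sets product_sigma" and B: "B \<in> sets product_sigma"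
  shows "emeasure N B = (\<integral>\<^sup>+f. fiber N f (Pair f -` B) \<partial>count_space UNIV)"
proof -
  have "B = (\<Union>f\<in>UNIV. {f} \<times> Pair f -` B)"
    by auto
  moreover have "emeasure N (\<Union>f\<in>UNIV. {f} \<times> Pair f -` B) =
      (\<integral>\<^sup>+f. emeasure N ({f} \<times> Pair f -` B) \<partial>count_space UNIV)"
    using B by (intro emeasure_UN_countable) (auto simp: N disjoint_family_on_def intro: fiber_set slice_set)
  ultimately show ?thesis
    unfolding fiber_def by simp
qed

lemma sets_action_kernel: "sets (action_kernel X act g K z) = sets product_sigma"
  unfolding action_kernel_def by (cases z) (auto intro!: sets_pair_measure_cong)

lemma action_kernel_fiber:
  assumes "A \<in> sets (borel_of X)" "x \<in> topspace X"
  shows "fiber (action_kernel X act g K (e, x)) f A = ennreal (pmf (K e) f) * indicator (preimage e A) x"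
proof -
  have y: "act (g e) x \<in> topspace X"
    using assms(2) act_closed g_carrier by blast
  interpret R: prob_space "return (borel_of X) (act (g e) x)"
    using y by (intro prob_space_return) simp
  have "fiber (action_kernel X act g K (e, x)) f A =
      emeasure (measure_pmf (K e)) {f} * emeasure (return (borel_of X) (act (g e) x)) A"
    unfolding fiber_def action_kernel_def prod.case using assms(1) by (intro R.emeasure_pair_measure_Times) auto
  also have "\<dots> = ennreal (pmf (K e) f) * indicator (preimage e A) x"
    using assms by (auto simp: emeasure_pmf_single preimage_def split: split_indicator)
  finally show ?thesis .
qed

lemma measurable_action_kernel_fiber:
  assumes A: "A \<in> sets (borel_of X)"
  shows "(\<lambda>z. fiber (action_kernel X act g K z) f A) \<in> borel_measurable product_sigma"
proof (rule measurable_pair_measure_countable1)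
  fix e
  have "(\<lambda>x. ennreal (pmf (K e) f) * indicator (preimage e A) x) \<in> borel_measurable (borel_of X)"
    using preimage_sets[OF A] by measurable
  then show "(\<lambda>x. fiber (action_kernel X act g K (e, x)) f A) \<in> borel_measurable (borel_of X)"
    by (subst measurable_cong[where g = "\<lambda>x. ennreal (pmf (K e) f) * indicator (preimage e A) x"])
       (auto simp: action_kernel_fiber[OF A])
qed simp

lemma nn_integral_action_kernel_fiber:
  assumes N: "sets N = sets product_sigma" and A: "A \<in> sets (borel_of X)"
  shows "(\<integral>\<^sup>+z. fiber (action_kernel X act g K z) f A \<partial>N) = step (fiber N) f A"
proof -
  have P: "{f'} \<times> preimage f' A \<in> sets N" for f'
    unfolding N using A by (intro fiber_set preimage_sets)
  have "(\<integral>\<^sup>+z. fiber (action_kernel X act g K z) f A \<partial>N) =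
      (\<integral>\<^sup>+z. (\<integral>\<^sup>+f'. ennreal (pmf (K f') f) * indicator ({f'} \<times> preimage f' A) z \<partial>count_space UNIV) \<partial>N)"
  proof (rule nn_integral_cong)
    fix z assume "z \<in> space N"
    then obtain e x where z: "z = (e, x)" "x \<in> topspace X"
      unfolding sets_eq_imp_space_eq[OF N] space_product_sigma by blast
    have "(\<integral>\<^sup>+f'. ennreal (pmf (K f') f) * indicator ({f'} \<times> preimage f' A) z \<partial>count_space UNIV) =
        (\<integral>\<^sup>+f'. (if f' = e then ennreal (pmf (K f') f) * indicator (preimage f' A) x else 0) \<partial>count_space UNIV)"
      by (intro nn_integral_cong) (auto simp: z split: split_indicator)
    then show "fiber (action_kernel X act g K z) f A =
        (\<integral>\<^sup>+f'. ennreal (pmf (K f') f) * indicator ({f'} \<times> preimage f' A) z \<partial>count_space UNIV)"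
      by (simp only: nn_integral_count_space_delta z(1) action_kernel_fiber[OF A z(2)])
  qed
  also have "\<dots> = (\<integral>\<^sup>+f'. (\<integral>\<^sup>+z. ennreal (pmf (K f') f) * indicator ({f'} \<times> preimage f' A) z \<partial>N) \<partial>count_space UNIV)"
    using P by (intro nn_integral_count_space_nn_integral) auto
  also have "\<dots> = step (fiber N) f A"
    unfolding step_def fiber_def using P by (intro nn_integral_cong) (simp add: nn_integral_cmult_indicator)
  finally show ?thesis .
qed

lemma action_stationary_iff:
  "N \<in> action_stationary_probs X act g K \<longleftrightarrow>
    prob_space N \<and> sets N = sets product_sigma \<and>
    (\<forall>f. \<forall>A\<in>sets (borel_of X). step (fiber N) f A = fiber N f A)"
proof -
  have "(\<forall>B\<in>sets product_sigma. emeasure N B = (\<integral>\<^sup>+z. emeasure (action_kernel X act g K z) B \<partial>N)) \<longleftrightarrow>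
      (\<forall>f. \<forall>A\<in>sets (borel_of X). step (fiber N) f A = fiber N f A)" (is "?L \<longleftrightarrow> ?R")
    if N: "sets N = sets product_sigma"
  proof
    assume L: ?L
    show ?R
    proof (intro allI ballI)
      fix f A assume A: "A \<in> sets (borel_of X)"
      show "step (fiber N) f A = fiber N f A"
        using nn_integral_action_kernel_fiber[OF N A, of f] L fiber_set[OF A, of f] by (simp add: fiber_def)
    qed
  next
    assume R: ?R
    show ?L
    proof
      fix B assume B: "B \<in> sets product_sigma"
      have "(\<integral>\<^sup>+z. emeasure (action_kernel X act g K z) B \<partial>N) =
          (\<integral>\<^sup>+z. (\<integral>\<^sup>+f. fiber (action_kernel X act g K z) f (Pair f -` B) \<partial>count_space UNIV) \<partial>N)"
        by (simp only: emeasure_eq_fibers[OF sets_action_kernel B])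
      also have "\<dots> = (\<integral>\<^sup>+f. (\<integral>\<^sup>+z. fiber (action_kernel X act g K z) f (Pair f -` B) \<partial>N) \<partial>count_space UNIV)"
        using measurable_action_kernel_fiber[OF slice_set[OF B]]
        by (intro nn_integral_count_space_nn_integral) (auto simp: measurable_cong_sets[OF N refl])
      also have "\<dots> = emeasure N B"
        unfolding emeasure_eq_fibers[OF N B] nn_integral_action_kernel_fiber[OF N slice_set[OF B]]
        using R slice_set[OF B] by (intro nn_integral_cong) auto
      finally show "emeasure N B = (\<integral>\<^sup>+z. emeasure (action_kernel X act g K z) B \<partial>N)" ..
    qed
  qed
  then show ?thesis
    unfolding action_stationary_probs_def stationary_probs_def by blast
qed

lemma sets_glue [simp]: "sets (glue m) = sets product_sigma"
  unfolding glue_def by (simp add: sets.sigma_sets_eq sets.space_closed)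

lemma emeasure_glue:
  assumes m: "\<And>f. countably_additive (sets (borel_of X)) (m f)" "\<And>f. m f {} = 0"
    and B: "B \<in> sets product_sigma"
  shows "emeasure (glue m) B = (\<integral>\<^sup>+f. m f (Pair f -` B) \<partial>count_space UNIV)"
  unfolding glue_def
proof (rule emeasure_measure_of_sigma[OF _ _ _ B])
  show "sigma_algebra (space product_sigma) (sets product_sigma)"
    by (rule sets.sigma_algebra_axioms)
  show "positive (sets product_sigma) (\<lambda>B. \<integral>\<^sup>+f. m f (Pair f -` B) \<partial>count_space UNIV)"
    by (simp add: positive_def m(2))
  show "countably_additive (sets product_sigma) (\<lambda>B. \<integral>\<^sup>+f. m f (Pair f -` B) \<partial>count_space UNIV)"
  proof (rule countably_additiveI)
    fix B :: "nat \<Rightarrow> ('e \<times> 'x) set"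
    assume B: "range B \<subseteq> sets product_sigma" "disjoint_family B"
    have "(\<Sum>i. \<integral>\<^sup>+f. m f (Pair f -` B i) \<partial>count_space UNIV) =
        (\<integral>\<^sup>+f. (\<Sum>i. m f (Pair f -` B i)) \<partial>count_space UNIV)"
      by (rule nn_integral_suminf[symmetric]) simp
    also have "\<dots> = (\<integral>\<^sup>+f. m f (\<Union>i. Pair f -` B i) \<partial>count_space UNIV)"
    proof (rule nn_integral_cong)
      fix f
      have "range (\<lambda>i. Pair f -` B i) \<subseteq> sets (borel_of X)"
        using B(1) slice_set by blast
      moreover have "disjoint_family (\<lambda>i. Pair f -` B i)"
        using B(2) unfolding disjoint_family_on_def by blast
      ultimately show "(\<Sum>i. m f (Pair f -` B i)) = m f (\<Union>i. Pair f -` B i)"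
        using m(1)[of f] unfolding countably_additive_def by blast
    qed
    finally show "(\<Sum>i. \<integral>\<^sup>+f. m f (Pair f -` B i) \<partial>count_space UNIV) =
        (\<integral>\<^sup>+f. m f (Pair f -` (\<Union>i. B i)) \<partial>count_space UNIV)"
      by (simp add: vimage_UN)
  qed
qed

lemma fiber_glue:
  assumes m: "\<And>f. countably_additive (sets (borel_of X)) (m f)" "\<And>f. m f {} = 0"
    and A: "A \<in> sets (borel_of X)"
  shows "fiber (glue m) f A = m f A"
proof -
  have "fiber (glue m) f A = (\<integral>\<^sup>+f'. (if f' = f then m f' A else 0) \<partial>count_space UNIV)"
    unfolding fiber_def emeasure_glue[OF m fiber_set[OF A]]
    by (intro nn_integral_cong) (auto simp: m(2) intro!: arg_cong[where f = "m _"])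
  then show ?thesis
    by (simp only: nn_integral_count_space_delta)
qed

lemma pull_empty: "pull w {} = {}"
proof (induction w)
  case (Cons x w)
  have "preimage x {} = {}"
    by (simp add: preimage_def)
  with Cons show ?case
    by simp
qed simp

lemma pull_UN: "pull w (\<Union>i. A i) = (\<Union>i. pull w (A i))"
proof (induction w arbitrary: A)
  case (Cons x w)
  have "preimage x (\<Union>i. A i) = (\<Union>i. preimage x (A i))"
    by (auto simp: preimage_def)
  then show ?case
    by (simp add: Cons.IH)
qed simp

lemma pull_Int: "pull w (A \<inter> B) = pull w A \<inter> pull w B"
proof (induction w arbitrary: A B)
  case (Cons x w)
  have "preimage x (A \<inter> B) = preimage x A \<inter> preimage x B"
    by (auto simp: preimage_def)
  then show ?case
    by (simp add: Cons.IH)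
qed simp

lemma pull_sets: "A \<in> sets (borel_of X) \<Longrightarrow> pull w A \<in> sets (borel_of X)"
  by (rule pull_closed[where B = "sets (borel_of X)"]) (rule preimage_sets)

lemma suspension_countably_additive:
  assumes h: "countably_additive (sets (borel_of X)) h"
  shows "countably_additive (sets (borel_of X)) (suspension e h f)"
proof (rule countably_additiveI)
  fix A :: "nat \<Rightarrow> 'x set"
  assume A: "range A \<subseteq> sets (borel_of X)" "disjoint_family A"
  have "(\<Sum>i. h (pull w (A i))) = h (pull w (\<Union>i. A i))" for w
  proof -
    have "disjoint_family (\<lambda>i. pull w (A i))"
      using A(2) unfolding disjoint_family_on_def by (auto simp: pull_Int[symmetric] pull_empty)
    moreover have "range (\<lambda>i. pull w (A i)) \<subseteq> sets (borel_of X)"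
      using A(1) pull_sets by blast
    ultimately show ?thesis
      using h unfolding countably_additive_def pull_UN by blast
  qed
  then have *: "(\<Sum>i. if c then h (pull w (A i)) else 0) = (if c then h (pull w (\<Union>i. A i)) else 0)" for c w
    by simp
  have "(\<Sum>i. excursion e h n f (A i)) = excursion e h n f (\<Union>i. A i)" for n
    unfolding excursion_path *[symmetric] by (rule nn_integral_suminf[symmetric]) simp
  then have "suspension e h f (\<Union>i. A i) = (\<integral>\<^sup>+n. (\<Sum>i. excursion e h n f (A i)) \<partial>count_space UNIV)"
    unfolding suspension_def nn_integral_count_space_nat by simp
  also have "\<dots> = (\<Sum>i. \<integral>\<^sup>+n. excursion e h n f (A i) \<partial>count_space UNIV)"
    by (rule nn_integral_suminf) simp
  also have "\<dots> = (\<Sum>i. suspension e h f (A i))"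
    unfolding suspension_def nn_integral_count_space_nat ..
  finally show "(\<Sum>i. suspension e h f (A i)) = suspension e h f (\<Union>i. A i)" ..
qed

lemma suspension_empty: "h {} = 0 \<Longrightarrow> suspension e h f {} = 0"
  unfolding suspension_def excursion_path by (simp add: pull_empty cong: if_cong)

lemma countably_additive_le_imp_eq:
  assumes a: "countably_additive (sets (borel_of X)) \<mu>" "\<mu> {} = 0"
    and b: "countably_additive (sets (borel_of X)) \<mu>'" "\<mu>' {} = 0"
    and le: "\<And>A. A \<in> sets (borel_of X) \<Longrightarrow> \<mu> A \<le> \<mu>' A"
    and total: "\<mu> (topspace X) = \<mu>' (topspace X)" "\<mu>' (topspace X) < \<infinity>"
    and A: "A \<in> sets (borel_of X)"
  shows "\<mu> A = \<mu>' A"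
proof -
  have split: "\<kappa> (topspace X) = \<kappa> A + \<kappa> (topspace X - A)"
    if "countably_additive (sets (borel_of X)) \<kappa>" "\<kappa> {} = 0" for \<kappa> :: "'x set \<Rightarrow> ennreal"
  proof -
    have "additive (sets (borel_of X)) \<kappa>"
      using that by (intro sets.countably_additive_additive) (auto simp: positive_def)
    moreover have "topspace X = A \<union> (topspace X - A)"
      using sets_borel_of_subset[OF A] by auto
    ultimately show ?thesis
      using A by (metis Diff_disjoint additiveD sets.Diff topspace_sets_borel_of)
  qed
  have C: "topspace X - A \<in> sets (borel_of X)"
    using A by auto
  have fin: "\<mu>' (topspace X - A) \<noteq> \<infinity>" "\<mu> (topspace X - A) \<noteq> \<infinity>"
    using total(2) le[OF C] unfolding split[OF b] by (auto simp: top_unique)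
  have "\<mu>' A = \<mu>' (topspace X) - \<mu>' (topspace X - A)"
    using fin(1) by (simp add: split[OF b])
  also have "\<dots> \<le> \<mu> (topspace X) - \<mu> (topspace X - A)"
    using le[OF C] by (simp add: total(1) ennreal_minus_mono)
  also have "\<dots> = \<mu> A"
    using fin(2) by (simp add: split[OF a])
  finally show ?thesis
    using le[OF A] by simp
qed

lemma fiber_countably_additive:
  assumes "sets N = sets product_sigma"
  shows "countably_additive (sets (borel_of X)) (fiber N f)"
proof (rule countably_additiveI)
  fix A :: "nat \<Rightarrow> 'x set"
  assume A: "range A \<subseteq> sets (borel_of X)" "disjoint_family A"
  have "(\<Sum>i. emeasure N ({f} \<times> A i)) = emeasure N (\<Union>i. {f} \<times> A i)"
    using A fiber_set by (intro suminf_emeasure) (auto simp: assms disjoint_family_on_def)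
  also have "(\<Union>i. {f} \<times> A i) = {f} \<times> (\<Union>i. A i)"
    by auto
  finally show "(\<Sum>i. fiber N f (A i)) = fiber N f (\<Union>i. A i)"
    unfolding fiber_def .
qed

lemma fiber_empty [simp]: "fiber N f {} = 0"
  by (simp add: fiber_def)

lemma nn_integral_fiber_topspace:
  assumes "prob_space N" "sets N = sets product_sigma"
  shows "(\<integral>\<^sup>+f. fiber N f (topspace X) \<partial>count_space UNIV) = 1"
proof -
  have "emeasure N (space product_sigma) = (\<integral>\<^sup>+f. fiber N f (topspace X) \<partial>count_space UNIV)"
    by (subst emeasure_eq_fibers[OF assms(2)])
       (auto simp: space_product_sigma intro!: nn_integral_cong arg_cong[where f = "fiber N _"])
  then show ?thesis
    using prob_space.emeasure_space_1[OF assms(1)] sets_eq_imp_space_eq[OF assms(2)] by simp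
qed

lemma fiber_eq_suspension:
  assumes N: "N \<in> action_stationary_probs X act g K" and A: "A \<in> sets (borel_of X)"
  shows "fiber N f A = suspension e (fiber N e) f A"
proof -
  have p: "prob_space N" and s: "sets N = sets product_sigma"
    and st: "\<And>f A. A \<in> sets (borel_of X) \<Longrightarrow> step (fiber N) f A = fiber N f A"
    using N unfolding action_stationary_iff by auto
  have eq: "fiber N f (topspace X) = suspension e (fiber N e) f (topspace X)"
    using nn_integral_fiber_topspace[OF p s]
    by (intro stationary_fixed_eq_suspension preimage_topspace st) auto
  have fin: "fiber N f (topspace X) < \<infinity>"
    using finite_measure.emeasure_finite[OF prob_space.finite_measure[OF p]]
    by (simp add: fiber_def less_top[symmetric])
  show ?thesis
  proof (rule countably_additive_le_imp_eq[where \<mu> = "suspension e (fiber N e) f" and \<mu>' = "fiber N f", symmetric, OF _ _ _ _ _ _ fin A])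
    show "suspension e (fiber N e) f (topspace X) = fiber N f (topspace X)"
      by (rule eq[symmetric])
    show "suspension e (fiber N e) f A \<le> fiber N f A" if "A \<in> sets (borel_of X)" for A
      using that st by (intro suspension_le[where B = "sets (borel_of X)"] preimage_sets) auto
  qed (intro suspension_countably_additive fiber_countably_additive s suspension_empty fiber_empty)+
qed

lemma first_return_fiber:
  assumes N: "N \<in> action_stationary_probs X act g K" and A: "A \<in> sets (borel_of X)"
  shows "first_return e (fiber N e) A = fiber N e A"
proof -
  have "first_return e (fiber N e) A = step (fiber N) e A"
    unfolding first_return_def using fiber_eq_suspension[OF N] preimage_sets[OF A]
    by (intro step_cong) simp
  then show ?thesis
    using N A unfolding action_stationary_iff by simp
qed

end

locale stationary_action_chain = action_chain G T X act g K
  for G :: "('g, 'm) monoid_scheme" and T :: "'g topology"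
    and X :: "'x topology" and act :: "'g \<Rightarrow> 'x \<Rightarrow> 'x"
    and g :: "'e::countable \<Rightarrow> 'g" and K :: "'e \<Rightarrow> 'e pmf" +
  fixes \<pi> :: "'e pmf" and \<nu> :: "('e \<times> 'x) measure"
  assumes \<pi>: "bind_pmf \<pi> K = \<pi>" and \<nu>: "\<nu> \<in> action_stationary_probs X act g K"
begin

lemma prob_\<nu>: "prob_space \<nu>" and sets_\<nu>: "sets \<nu> = sets product_sigma"
  and step_fiber: "A \<in> sets (borel_of X) \<Longrightarrow> step (fiber \<nu>) f A = fiber \<nu> f A"
  using \<nu> unfolding action_stationary_iff by auto

lemma step_pmf: "step (\<lambda>f _. ennreal (pmf \<pi> f)) f A = ennreal (pmf \<pi> f)"
proof -
  have "ennreal (pmf \<pi> f) = (\<integral>\<^sup>+f'. ennreal (pmf (K f') f) \<partial>\<pi>)"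
    by (subst \<pi>[symmetric]) (rule ennreal_pmf_bind)
  then show ?thesis
    unfolding step_def nn_integral_measure_pmf by (simp add: mult.commute)
qed

lemma pmf_pos: "0 < pmf \<pi> f"
proof -
  obtain e where e: "e \<in> set_pmf \<pi>"
    using set_pmf_not_empty by fast
  obtain w where "admissible K f e w"
    using irreducible_chain_admissible[OF irred] .
  from admissible_le[of UNIV, OF _ this] step_pmf
  obtain c where "c \<noteq> 0" "c * ennreal (pmf \<pi> e) \<le> ennreal (pmf \<pi> f)"
    by (metis UNIV_I order_refl)
  moreover have "ennreal (pmf \<pi> e) \<noteq> 0"
    using e by (simp add: set_pmf_iff)
  ultimately have "ennreal (pmf \<pi> f) \<noteq> 0"
    by (metis le_zero_eq mult_eq_0_iff)
  then show ?thesis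
    by (simp add: pmf_positive_iff set_pmf_iff)
qed

text \<open>Both marginals are multiples of the occupation measure \<open>suspension e (\<lambda>_. 1)\<close>.\<close>

lemma fiber_topspace: "fiber \<nu> e (topspace X) = ennreal (pmf \<pi> e)"
proof -
  define u where "u f = suspension e (\<lambda>_. 1) f (topspace X)" for f
  have q: "fiber \<nu> f (topspace X) = fiber \<nu> e (topspace X) * u f" for f
    using fiber_eq_suspension[OF \<nu> topspace_sets_borel_of, of f e]
      suspension_fixed[OF preimage_topspace, of e "fiber \<nu> e" f] by (simp add: u_def)
  have \<pi>1: "(\<integral>\<^sup>+f. ennreal (pmf \<pi> f) \<partial>count_space UNIV) = 1"
    using measure_pmf.emeasure_space_1[of \<pi>] by (simp add: nn_integral_pmf)
  have p: "ennreal (pmf \<pi> f) = ennreal (pmf \<pi> e) * u f" for f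
    using stationary_fixed_eq_suspension[where m = "\<lambda>f _. ennreal (pmf \<pi> f)" and b = "topspace X", OF preimage_topspace step_pmf]
      \<pi>1 suspension_fixed[OF preimage_topspace, of e "\<lambda>_. ennreal (pmf \<pi> e)" f] by (simp add: u_def)
  have "(\<integral>\<^sup>+f. fiber \<nu> e (topspace X) * u f \<partial>count_space UNIV) = 1"
    unfolding q[symmetric] by (rule nn_integral_fiber_topspace[OF prob_\<nu> sets_\<nu>])
  then have 1: "fiber \<nu> e (topspace X) * (\<integral>\<^sup>+f. u f \<partial>count_space UNIV) = 1"
    by (simp add: nn_integral_cmult)
  have "(\<integral>\<^sup>+f. ennreal (pmf \<pi> e) * u f \<partial>count_space UNIV) = 1"
    unfolding p[symmetric] by (rule \<pi>1)
  then have 2: "ennreal (pmf \<pi> e) * (\<integral>\<^sup>+f. u f \<partial>count_space UNIV) = 1"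
    by (simp add: nn_integral_cmult)
  show ?thesis
    using 1 2 by (metis mult.commute mult.left_commute mult.right_neutral)
qed

definition disintegration :: "'e \<Rightarrow> 'x measure" where
  "disintegration e = scale_measure (inverse (ennreal (pmf \<pi> e)))
     (distr (density \<nu> (indicator ({e} \<times> topspace X))) (borel_of X) snd)"

lemma sets_disintegration [simp]: "sets (disintegration e) = sets (borel_of X)"
  by (simp add: disintegration_def)

lemma space_disintegration [simp]: "space (disintegration e) = topspace X"
  using sets_eq_imp_space_eq[OF sets_disintegration] by simp

lemma emeasure_disintegration:
  assumes A: "A \<in> sets (borel_of X)"
  shows "emeasure (disintegration e) A = inverse (ennreal (pmf \<pi> e)) * fiber \<nu> e A"
proof -
  have snd: "snd \<in> measurable \<nu> (borel_of X)"
    unfolding measurable_cong_sets[OF sets_\<nu> refl] by simp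
  have "emeasure (distr (density \<nu> (indicator ({e} \<times> topspace X))) (borel_of X) snd) A =
      emeasure (density \<nu> (indicator ({e} \<times> topspace X))) (snd -` A \<inter> space \<nu>)"
    using snd A by (subst emeasure_distr) auto
  also have "\<dots> = emeasure \<nu> (({e} \<times> topspace X) \<inter> (snd -` A \<inter> space \<nu>))"
    using snd A by (intro emeasure_restricted measurable_sets) (auto simp: sets_\<nu> intro!: fiber_set)
  also have "({e} \<times> topspace X) \<inter> (snd -` A \<inter> space \<nu>) = {e} \<times> A"
    using sets_borel_of_subset[OF A] by (auto simp: sets_eq_imp_space_eq[OF sets_\<nu>] space_product_sigma)
  finally show ?thesis
    by (simp add: disintegration_def fiber_def)
qed

lemma pmf_mult_disintegration:
  assumes "A \<in> sets (borel_of X)"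
  shows "ennreal (pmf \<pi> e) * emeasure (disintegration e) A = fiber \<nu> e A"
proof -
  have "ennreal (pmf \<pi> e) * inverse (ennreal (pmf \<pi> e)) = 1"
    unfolding divide_ennreal_def[symmetric] using pmf_pos[of e] by (intro ennreal_divide_self) auto
  then show ?thesis
    unfolding emeasure_disintegration[OF assms] by (simp add: mult.assoc[symmetric])
qed

lemma pmf_mult_cancel: "ennreal (pmf \<pi> e) * a = ennreal (pmf \<pi> e) * b \<longleftrightarrow> a = b"
  using pmf_pos[of e] by (auto simp: ennreal_mult_cancel_left)

lemma prob_space_disintegration: "prob_space (disintegration e)"
proof
  have "ennreal (pmf \<pi> e) * emeasure (disintegration e) (topspace X) = ennreal (pmf \<pi> e) * 1"
    by (simp add: pmf_mult_disintegration fiber_topspace)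
  then show "emeasure (disintegration e) (space (disintegration e)) = 1"
    unfolding pmf_mult_cancel by simp
qed

lemma disintegration_null_iff:
  "A \<in> sets (borel_of X) \<Longrightarrow> emeasure (disintegration e) A = 0 \<longleftrightarrow> fiber \<nu> e A = 0"
  using pmf_mult_disintegration[of A e] pmf_pos[of e] by (metis ennreal_eq_0_iff mult_eq_0_iff not_less)

lemma disintegration_decomposition:
  assumes B: "B \<in> sets product_sigma"
  shows "emeasure \<nu> B = (\<integral>\<^sup>+e. ennreal (pmf \<pi> e) *
    emeasure (return (count_space UNIV) e \<Otimes>\<^sub>M disintegration e) B \<partial>count_space UNIV)"
  unfolding emeasure_eq_fibers[OF sets_\<nu> B]
proof (rule nn_integral_cong)
  fix e
  interpret prob_space "disintegration e"
    by (rule prob_space_disintegration)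
  have "sets (return (count_space UNIV) e \<Otimes>\<^sub>M disintegration e) = sets product_sigma"
    by (intro sets_pair_measure_cong) auto
  then have "emeasure (return (count_space UNIV) e \<Otimes>\<^sub>M disintegration e) B = emeasure (disintegration e) (Pair e -` B)"
    using B by (subst emeasure_pair_measure_alt) (auto simp: nn_integral_return)
  then show "fiber \<nu> e (Pair e -` B) =
      ennreal (pmf \<pi> e) * emeasure (return (count_space UNIV) e \<Otimes>\<^sub>M disintegration e) B"
    using pmf_mult_disintegration[OF slice_set[OF B]] by simp
qed

lemma disintegration_equation:
  assumes A: "A \<in> sets (borel_of X)"
  shows "ennreal (pmf \<pi> e) * emeasure (disintegration e) A =
    (\<integral>\<^sup>+e'. ennreal (pmf \<pi> e') * ennreal (pmf (K e') e) *
      emeasure (pushforward X (act (g e')) (disintegration e')) A \<partial>count_space UNIV)"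
proof -
  have "fiber \<nu> e A = step (fiber \<nu>) e A"
    using step_fiber[OF A] ..
  also have "\<dots> = (\<integral>\<^sup>+e'. ennreal (pmf \<pi> e') * ennreal (pmf (K e') e) *
      emeasure (pushforward X (act (g e')) (disintegration e')) A \<partial>count_space UNIV)"
    unfolding step_def emeasure_pushforward[OF sets_disintegration g_carrier A] preimage_def[symmetric]
      pmf_mult_disintegration[OF preimage_sets[OF A], symmetric]
    by (simp add: ac_simps)
  finally show ?thesis
    unfolding pmf_mult_disintegration[OF A] .
qed

lemma first_return_disintegration:
  assumes A: "A \<in> sets (borel_of X)"
  shows "first_return e (emeasure (disintegration e)) A = emeasure (disintegration e) A"
proof -
  have "first_return e (emeasure (disintegration e)) A =
      first_return e (\<lambda>A. inverse (ennreal (pmf \<pi> e)) * fiber \<nu> e A) A"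
    using A by (intro first_return_cong[where B = "sets (borel_of X)"] preimage_sets emeasure_disintegration)
  then show ?thesis
    by (simp add: first_return_cmult first_return_fiber[OF \<nu> A] emeasure_disintegration[OF A])
qed

lemma disintegration_stationary:
  "disintegration e \<in> convolution_stationary_probs X act (renewal_measure G T g K e)"
  unfolding convolution_stationary_iff
  using first_return_disintegration prob_space_disintegration by simp

lemma suspension_stationary:
  assumes \<eta>: "\<eta> \<in> convolution_stationary_probs X act (renewal_measure G T g K e)"
  defines "m \<equiv> \<lambda>f A. ennreal (pmf \<pi> e) * suspension e (emeasure \<eta>) f A"
  shows "glue m \<in> action_stationary_probs X act g K"
    and "\<And>f A. A \<in> sets (borel_of X) \<Longrightarrow> fiber (glue m) f A = m f A"
proof -
  have p: "prob_space \<eta>" and s: "sets \<eta> = sets (borel_of X)"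
    and r: "\<And>A. A \<in> sets (borel_of X) \<Longrightarrow> first_return e (emeasure \<eta>) A = emeasure \<eta> A"
    using \<eta> unfolding convolution_stationary_iff by auto
  have "countably_additive (sets (borel_of X)) (emeasure \<eta>)"
    using emeasure_countably_additive[of \<eta>] s by simp
  from suspension_countably_additive[OF this]
  have a: "countably_additive (sets (borel_of X)) (m f)" for f
    unfolding countably_additive_def m_def by simp
  have z: "m f {} = 0" for f
    unfolding m_def by (simp add: suspension_empty)
  show fib: "\<And>f A. A \<in> sets (borel_of X) \<Longrightarrow> fiber (glue m) f A = m f A"
    using a z by (rule fiber_glue)
  have total: "m f (topspace X) = fiber \<nu> f (topspace X)" for f
  proof -
    have "emeasure \<eta> (topspace X) = 1"
      using prob_space.emeasure_space_1[OF p] sets_eq_imp_space_eq[OF s] by simp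
    then have "m f (topspace X) = ennreal (pmf \<pi> e) * suspension e (\<lambda>_. 1) f (topspace X)"
      unfolding m_def suspension_fixed[OF preimage_topspace, of e "emeasure \<eta>"] by simp
    also have "\<dots> = suspension e (fiber \<nu> e) f (topspace X)"
      unfolding suspension_fixed[OF preimage_topspace, of e "fiber \<nu> e"] fiber_topspace ..
    finally show ?thesis
      unfolding fiber_eq_suspension[OF \<nu> topspace_sets_borel_of, of f e] .
  qed
  have "prob_space (glue m)"
  proof
    have "emeasure (glue m) (space product_sigma) = (\<integral>\<^sup>+f. fiber (glue m) f (topspace X) \<partial>count_space UNIV)"
      by (subst emeasure_eq_fibers)
         (auto simp: space_product_sigma intro!: nn_integral_cong arg_cong[where f = "fiber (glue m) _"])
    also have "\<dots> = 1"
      unfolding fib[OF topspace_sets_borel_of] total by (rule nn_integral_fiber_topspace[OF prob_\<nu> sets_\<nu>])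
    finally show "emeasure (glue m) (space (glue m)) = 1"
      unfolding sets_eq_imp_space_eq[OF sets_glue] .
  qed
  moreover have "step (fiber (glue m)) f A = fiber (glue m) f A" if A: "A \<in> sets (borel_of X)" for f A
  proof -
    have "step (fiber (glue m)) f A = step m f A"
      using fib preimage_sets[OF A] by (intro step_cong) simp
    also have "\<dots> = m f A"
      unfolding m_def step_cmult step_suspension by (auto simp: r[OF A])
    finally show ?thesis
      by (simp add: fib[OF A])
  qed
  ultimately show "glue m \<in> action_stationary_probs X act g K"
    unfolding action_stationary_iff by simp
qed

lemma disintegration_extremal:
  assumes ext: "extremal_in (action_stationary_probs X act g K) \<nu>"
  shows "extremal_in (convolution_stationary_probs X act (renewal_measure G T g K e)) (disintegration e)"
  unfolding extremal_in_def
proof (intro conjI ballI allI impI disintegration_stationary)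
  let ?S = "convolution_stationary_probs X act (renewal_measure G T g K e)"
  fix \<eta>1 \<eta>2 and t :: real
  assume \<eta>: "\<eta>1 \<in> ?S" "\<eta>2 \<in> ?S"
    and t: "0 < t \<and> t < 1 \<and> (\<forall>A\<in>sets (disintegration e). emeasure (disintegration e) A =
      ennreal t * emeasure \<eta>1 A + ennreal (1 - t) * emeasure \<eta>2 A)"
  define m where "m \<eta> f A = ennreal (pmf \<pi> e) * suspension e (emeasure \<eta>) f A" for \<eta> f and A :: "'x set"
  have m: "glue (m \<eta>) \<in> action_stationary_probs X act g K"
    "\<And>f A. A \<in> sets (borel_of X) \<Longrightarrow> fiber (glue (m \<eta>)) f A = m \<eta> f A" if "\<eta> \<in> ?S" for \<eta>
    using suspension_stationary[OF that] unfolding m_def by auto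
  have fib: "fiber \<nu> f A = ennreal t * m \<eta>1 f A + ennreal (1 - t) * m \<eta>2 f A" if A: "A \<in> sets (borel_of X)" for f A
  proof -
    have "fiber \<nu> f A = suspension e (fiber \<nu> e) f A"
      by (rule fiber_eq_suspension[OF \<nu> A])
    also have "\<dots> = suspension e (\<lambda>A. ennreal (pmf \<pi> e) *
        (ennreal t * emeasure \<eta>1 A + ennreal (1 - t) * emeasure \<eta>2 A)) f A"
      using A t by (intro suspension_cong[where B = "sets (borel_of X)"] preimage_sets)
        (auto simp: pmf_mult_disintegration[symmetric])
    also have "\<dots> = ennreal t * m \<eta>1 f A + ennreal (1 - t) * m \<eta>2 f A"
      unfolding suspension_cmult suspension_add m_def by (simp add: distrib_left ac_simps)
    finally show ?thesis .
  qed
  have "emeasure \<nu> B = ennreal t * emeasure (glue (m \<eta>1)) B + ennreal (1 - t) * emeasure (glue (m \<eta>2)) B"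
    if "B \<in> sets \<nu>" for B
  proof -
    have B: "B \<in> sets product_sigma"
      using that sets_\<nu> by simp
    show ?thesis
      unfolding emeasure_eq_fibers[OF sets_\<nu> B] emeasure_eq_fibers[OF sets_glue B]
        fib[OF slice_set[OF B]] m(2)[OF \<eta>(1) slice_set[OF B]] m(2)[OF \<eta>(2) slice_set[OF B]]
      by (simp add: nn_integral_add nn_integral_cmult)
  qed
  then have eq: "glue (m \<eta>1) = \<nu>" "glue (m \<eta>2) = \<nu>"
    using ext m(1)[OF \<eta>(1)] m(1)[OF \<eta>(2)] t unfolding extremal_in_def by blast+
  have "\<eta> = disintegration e" if \<eta>: "\<eta> \<in> ?S" "glue (m \<eta>) = \<nu>" for \<eta>
  proof (rule measure_eqI)
    show s: "sets \<eta> = sets (disintegration e)"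
      using \<eta>(1) unfolding convolution_stationary_iff by simp
    fix A assume "A \<in> sets \<eta>"
    then have A: "A \<in> sets (borel_of X)"
      using s by simp
    have "ennreal (pmf \<pi> e) * emeasure \<eta> A = ennreal (pmf \<pi> e) * emeasure (disintegration e) A"
      using m(2)[OF \<eta>(1) A, of e] unfolding \<eta>(2) pmf_mult_disintegration[OF A] by (simp add: m_def)
    then show "emeasure \<eta> A = emeasure (disintegration e) A"
      unfolding pmf_mult_cancel .
  qed
  then show "\<eta>1 = disintegration e" "\<eta>2 = disintegration e"
    using \<eta> eq by blast+
qed

lemma admissible_pull_null:
  assumes "admissible K e e' w" "A \<in> sets (borel_of X)" "fiber \<nu> e A = 0"
  shows "fiber \<nu> e' (pull w A) = 0"
proof -
  obtain c where c: "c \<noteq> 0"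
    and le: "\<And>m. \<forall>f. \<forall>b\<in>sets (borel_of X). step m f b \<le> m f b \<Longrightarrow>
      \<forall>b\<in>sets (borel_of X). c * m e' (pull w b) \<le> m e b"
    using admissible_le[OF preimage_sets assms(1)] by blast
  have "c * fiber \<nu> e' (pull w A) \<le> fiber \<nu> e A"
    using le[of "fiber \<nu>"] step_fiber assms(2) by simp
  with c assms(3) show ?thesis
    by simp
qed

lemma emeasure_pushforward_word:
  assumes A: "A \<in> sets (borel_of X)"
  shows "emeasure (pushforward X (act (word_prod G g w)) (disintegration e)) A = emeasure (disintegration e) (pull w A)"
  using emeasure_pushforward[OF sets_disintegration word_prod_closed A] pull_eq_vimage[OF sets_borel_of_subset[OF A]] by simp

lemma disintegration_pushforward_null:
  assumes "admissible K e e' w"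
  shows "null_sets (disintegration e) \<subseteq> null_sets (pushforward X (act (word_prod G g w)) (disintegration e'))"
proof
  fix A assume "A \<in> null_sets (disintegration e)"
  then have A: "A \<in> sets (borel_of X)" "fiber \<nu> e A = 0"
    by (auto simp: null_sets_def disintegration_null_iff)
  then have "emeasure (disintegration e') (pull w A) = 0"
    using admissible_pull_null[OF assms A] by (simp add: disintegration_null_iff pull_sets)
  with A(1) show "A \<in> null_sets (pushforward X (act (word_prod G g w)) (disintegration e'))"
    by (simp add: null_sets_def emeasure_pushforward_word)
qed

lemma disintegration_pushforward_equivalent:
  assumes w: "admissible K e e' w"
    and inv: "\<And>h. h \<in> renewal_semigroup G T g K e \<Longrightarrow> pushforward X (act h) (disintegration e) = disintegration e"
  shows "null_sets (pushforward X (act (word_prod G g w)) (disintegration e')) = null_sets (disintegration e)"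
proof
  show "null_sets (pushforward X (act (word_prod G g w)) (disintegration e')) \<subseteq> null_sets (disintegration e)"
  proof
    fix A assume "A \<in> null_sets (pushforward X (act (word_prod G g w)) (disintegration e'))"
    then have A: "A \<in> sets (borel_of X)" and "emeasure (disintegration e') (pull w A) = 0"
      by (auto simp: null_sets_def emeasure_pushforward_word)
    then have 0: "fiber \<nu> e' (pull w A) = 0"
      by (simp add: disintegration_null_iff pull_sets)
    obtain v where v: "admissible K e' e v"
      using irreducible_chain_admissible[OF irred] .
    have ne: "w \<noteq> []" "v \<noteq> []"
      using w v by auto
    have "fiber \<nu> e (pull (w @ v) A) = 0"
      unfolding pull_append using admissible_pull_null[OF v pull_sets[OF A] 0] .
    then have "emeasure (pushforward X (act (word_prod G g (w @ v))) (disintegration e)) A = 0"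
      by (simp add: emeasure_pushforward_word A disintegration_null_iff pull_sets)
    moreover have "admissible K e e (w @ v)"
      using w v admissible_last[OF w] by (simp add: admissible_append[OF ne])
    ultimately show "A \<in> null_sets (disintegration e)"
      using A by (simp add: null_sets_def inv loop_in_renewal_semigroup)
  qed
qed (rule disintegration_pushforward_null[OF w])

end

theorem lemma3p7:
  fixes G :: "('g, 'm) monoid_scheme" and T :: "'g topology"
    and X :: "'x topology" and act :: "'g \<Rightarrow> 'x \<Rightarrow> 'x"
    and g :: "'e::countable \<Rightarrow> 'g" and K :: "'e \<Rightarrow> 'e pmf" and \<pi> :: "'e pmf"
    and \<nu> :: "('e \<times> 'x) measure"
  assumes "lie_group G T"
    and "locally_compact_space X" and "second_countable X" and "metrizable_space X"
    and "continuous_action G T X act"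
    and "\<And>e. g e \<in> carrier G"
    and "irreducible_chain K" and "positive_recurrent K"
    and "bind_pmf \<pi> K = \<pi>"
    and "\<nu> \<in> action_stationary_probs X act g K"
  shows "\<exists>\<nu>\<^sub>E :: 'e \<Rightarrow> 'x measure.
    (\<forall>A \<in> sets (count_space UNIV \<Otimes>\<^sub>M borel_of X). emeasure \<nu> A =
       (\<integral>\<^sup>+e. ennreal (pmf \<pi> e) * emeasure (return (count_space UNIV) e \<Otimes>\<^sub>M \<nu>\<^sub>E e) A
          \<partial>count_space UNIV)) \<and>
    (\<forall>e. \<nu>\<^sub>E e \<in> convolution_stationary_probs X act (renewal_measure G T g K e)) \<and>
    (\<forall>e. \<forall>A \<in> sets (borel_of X). ennreal (pmf \<pi> e) * emeasure (\<nu>\<^sub>E e) A =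
       (\<integral>\<^sup>+e'. ennreal (pmf \<pi> e') * ennreal (pmf (K e') e) *
                emeasure (pushforward X (act (g e')) (\<nu>\<^sub>E e')) A \<partial>count_space UNIV)) \<and>
    (extremal_in (action_stationary_probs X act g K) \<nu> \<longrightarrow>
       (\<forall>e. extremal_in (convolution_stationary_probs X act (renewal_measure G T g K e)) (\<nu>\<^sub>E e))) \<and>
    (\<forall>e e' c. admissible K e e' c \<longrightarrow>
       absolutely_continuous (\<nu>\<^sub>E e) (pushforward X (act (word_prod G g c)) (\<nu>\<^sub>E e')) \<and>
       ((\<forall>h \<in> renewal_semigroup G T g K e. pushforward X (act h) (\<nu>\<^sub>E e) = \<nu>\<^sub>E e) \<longrightarrow>
          null_sets (pushforward X (act (word_prod G g c)) (\<nu>\<^sub>E e')) = null_sets (\<nu>\<^sub>E e)))"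
proof -
  interpret stationary_action_chain G T X act g K \<pi> \<nu>
    using assms
    by (intro stationary_action_chain.intro action_chain.intro stationary_action_chain_axioms.intro)
       (auto simp: lie_group_def)
  show ?thesis
  proof (intro exI[of _ disintegration] conjI ballI allI impI)
    fix e e' c
    assume c: "admissible K e e' c"
    then show "absolutely_continuous (disintegration e) (pushforward X (act (word_prod G g c)) (disintegration e'))"
      unfolding absolutely_continuous_def by (rule disintegration_pushforward_null)
    assume "\<forall>h\<in>renewal_semigroup G T g K e. pushforward X (act h) (disintegration e) = disintegration e"
    then show "null_sets (pushforward X (act (word_prod G g c)) (disintegration e')) = null_sets (disintegration e)"
      using disintegration_pushforward_equivalent[OF c] by blast
  qed (rule disintegration_decomposition disintegration_stationary disintegration_equation
      disintegration_extremal; assumption)+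
qed

end
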